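(* Let $0<R<1$ and let $N,N'\in\mathbb{Z}$. Let $f,g\in L^{\infty}(\partial A)$ be functions whose Fourier expansions on the two boundary circles have the form $$g(re^{i\theta})=\sum_{k=-\infty}^{N}g_k(r)e^{ik\theta},\qquad f(re^{i\theta})=\sum_{k=-\infty}^{N'}f_k(r)e^{ik\theta},\qquad r\in\{R,1\},$$ that is, for each $r\in\{R,1\}$ the $k$-th Fourier coefficient of $e^{i\theta}\mapsto g(re^{i\theta})$ vanishes for $k>N$ and the $k$-th Fourier coefficient of $e^{i\theta}\mapsto f(re^{i\theta})$ vanishes for $k>N'$. If $T_fT_g=0$ on $H^2(\partial A)$, then $f=0$ or $g=0$ (almost everywhere on $\partial A$).
   Context: $A=\{z\in\mathbb{C}:R<|z|<1\}$, with boundary $\partial A=C\cup C_0$, where $C=\{|z|=1\}$ and $C_0=\{|z|=R\}$. $\sigma$ is the measure on $\partial A$ which is normalized angular Lebesgue measure $\frac{dt}{2\pi}$ on each of the two circles (so $\sigma(\partial A)=2$). $L^2(\partial A)=L^2(\partial A,\sigma)$ has inner product $$\langle f,g\rangle_{\partial A}=\frac1{2\pi}\int_0^{2\pi}f(e^{it})\overline{g(e^{it})}\,dt+\frac1{2\pi}\int_0^{2\pi}f(Re^{it})\overline{g(Re^{it})}\,dt,$$ and $L^\infty(\partial A)$ is the space of $\sigma$-essentially bounded functions. The Hardy space $H^2(\partial A)$ is the closure in $L^2(\partial A)$ of the rational functions with no poles in $\overline{A}$; equivalently, it has orthonormal basis $e_n(z)=\frac{1}{\sqrt{1+R^{2n}}}z^n$,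 $n\in\mathbb{Z}$. $P_R$ is the orthogonal projection of $L^2(\partial A)$ onto $H^2(\partial A)$, and for $f\in L^\infty(\partial A)$ the Toeplitz operator $T_f:H^2(\partial A)\to H^2(\partial A)$ is $T_fh=P_R(fh)$. For $r\in\{R,1\}$, $f_k(r)=\frac1{2\pi}\int_0^{2\pi}f(re^{i\theta})e^{-ik\theta}\,d\theta$, and similarly for $g_k(r)$. *)

theory Defs
  imports "HOL-Probability.Probability" "HOL-Computational_Algebra.Polynomial"
begin

definition annulus :: "real \<Rightarrow> complex set" where
  "annulus R = {z. R < norm z \<and> norm z < 1}"

definition annulus_bdry :: "real \<Rightarrow> complex set" where
  "annulus_bdry R = sphere 0 1 \<union> sphere 0 R"

text \<open>
  The measure \<open>\<sigma>\<close> on the boundary: the image of (counting measure on the two radii) times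
  (\<open>dt/(2\<pi>)\<close> on \<open>[0,2\<pi>]\<close>) under polar coordinates. For \<open>R \<noteq> 1\<close> it has total mass 2.
\<close>

definition bdry_measure :: "real \<Rightarrow> complex measure" where
  "bdry_measure R =
     distr (count_space {R, 1} \<Otimes>\<^sub>M uniform_measure lborel {0..2*pi})
       (restrict_space borel (annulus_bdry R))
       (\<lambda>(r, t). of_real r * cis t)"

text \<open>
  Elements of \<open>L\<^sup>2\<close>, \<open>L\<^sup>\<infinity>\<close> and the Hardy space are represented by functions; two functions
  stand for the same element iff they agree almost everywhere with respect to \<open>bdry_measure R\<close>.
  Only their values on \<open>annulus_bdry R\<close>, the space of this measure, matter.
\<close>

definition L2_bdry :: "real \<Rightarrow> (complex \<Rightarrow> complex) set" where
  "L2_bdry R = {f \<in> borel_measurable (bdry_measure R).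
     integrable (bdry_measure R) (\<lambda>z. (norm (f z))\<^sup>2)}"

definition Linf_bdry :: "real \<Rightarrow> (complex \<Rightarrow> complex) set" where
  "Linf_bdry R = {f \<in> borel_measurable (bdry_measure R).
     \<exists>B::real. AE z in bdry_measure R. norm (f z) \<le> B}"

definition inner_bdry :: "real \<Rightarrow> (complex \<Rightarrow> complex) \<Rightarrow> (complex \<Rightarrow> complex) \<Rightarrow> complex" where
  "inner_bdry R f g = (LINT z|bdry_measure R. f z * cnj (g z))"

definition norm_bdry :: "real \<Rightarrow> (complex \<Rightarrow> complex) \<Rightarrow> real" where
  "norm_bdry R f = sqrt (LINT z|bdry_measure R. (norm (f z))\<^sup>2)"

definition rational_no_poles :: "real \<Rightarrow> (complex \<Rightarrow> complex) set" where
  "rational_no_poles R =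
     {(\<lambda>z. poly p z / poly q z) | p q. \<forall>z\<in>closure (annulus R). poly q z \<noteq> 0}"

definition hardy_bdry :: "real \<Rightarrow> (complex \<Rightarrow> complex) set" where
  "hardy_bdry R = {h \<in> L2_bdry R.
     \<forall>\<epsilon>>0. \<exists>\<phi>\<in>rational_no_poles R. norm_bdry R (\<lambda>z. h z - \<phi> z) < \<epsilon>}"

text \<open>
  The orthogonal projection of \<open>u \<in> L2_bdry R\<close> is determined only almost everywhere, hence the
  choice of a representative.
\<close>

definition hardy_proj :: "real \<Rightarrow> (complex \<Rightarrow> complex) \<Rightarrow> (complex \<Rightarrow> complex)" where
  "hardy_proj R u = (SOME p. p \<in> hardy_bdry R \<and>
     (\<forall>q\<in>hardy_bdry R. inner_bdry R (\<lambda>z. u z - p z) q = 0))"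

definition toeplitz :: "real \<Rightarrow> (complex \<Rightarrow> complex) \<Rightarrow> (complex \<Rightarrow> complex) \<Rightarrow> (complex \<Rightarrow> complex)" where
  "toeplitz R f h = hardy_proj R (\<lambda>z. f z * h z)"

definition fourier_coeff :: "(complex \<Rightarrow> complex) \<Rightarrow> real \<Rightarrow> int \<Rightarrow> complex" where
  "fourier_coeff f r k =
     of_real (1 / (2 * pi)) *
     (LINT \<theta>:{0..2*pi}|lborel. f (of_real r * cis \<theta>) * cis (- of_int k * \<theta>))"

lemma space_bdry_measure [simp]: "space (bdry_measure R) = annulus_bdry R"
  by (simp add: bdry_measure_def space_restrict_space)

lemma sets_bdry_measure [measurable_cong]:
  "sets (bdry_measure R) = sets (restrict_space borel (annulus_bdry R))"
  by (simp add: bdry_measure_def)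

lemma prob_space_uniform: "prob_space (uniform_measure lborel {0..2*pi::real})"
  by (rule prob_space_uniform_measure) auto

lemma polar_measurable [measurable]:
  assumes "0 \<le> R"
  shows "(\<lambda>(r, t). of_real r * cis t) \<in>
    (count_space {R, 1} \<Otimes>\<^sub>M uniform_measure lborel {0..2*pi}) \<rightarrow>\<^sub>M
    restrict_space borel (annulus_bdry R)"
proof (rule measurable_restrict_space2)
  show "(\<lambda>(r, t). of_real r * cis t) \<in> space (count_space {R, 1} \<Otimes>\<^sub>M
      uniform_measure lborel {0..2*pi}) \<rightarrow> annulus_bdry R"
    using assms by (auto simp: space_pair_measure annulus_bdry_def norm_mult)
  have 1: "(\<lambda>t. of_real r * cis t) \<in> borel_measurable borel" for r
    by (intro borel_measurable_continuous_onI continuous_intros)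
  have "(\<lambda>x. of_real (fst x) * cis (snd x)) \<in>
      borel_measurable (count_space {R, 1} \<Otimes>\<^sub>M uniform_measure lborel {0..2*pi})"
  proof (rule measurable_compose_countable'[where I = "{R, 1}" and g = fst
        and f = "\<lambda>r x. of_real r * cis (snd x)"])
    fix r
    show "(\<lambda>x. of_real r * cis (snd x)) \<in>
        borel_measurable (count_space {R, 1} \<Otimes>\<^sub>M uniform_measure lborel {0..2*pi})"
      by (rule measurable_compose[OF measurable_snd]) (use 1[of r] in simp)
  qed simp_all
  then show "(\<lambda>(r, t). of_real r * cis t) \<in>
      borel_measurable (count_space {R, 1} \<Otimes>\<^sub>M uniform_measure lborel {0..2*pi})"
    by (simp add: case_prod_beta')
qed

lemma emeasure_bdry_measure_space:
  assumes "0 \<le> R" "R < 1"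
  shows "emeasure (bdry_measure R) (annulus_bdry R) = 2"
proof -
  interpret U: prob_space "uniform_measure lborel {0..2*pi::real}" by (rule prob_space_uniform)
  interpret F: finite_measure "count_space {R, 1}" by (rule finite_measure_count_space) simp
  let ?P = "count_space {R, 1} \<Otimes>\<^sub>M uniform_measure lborel {0..2*pi::real}"
  have "emeasure (bdry_measure R) (annulus_bdry R) =
      emeasure ?P ((\<lambda>(r, t). of_real r * cis t) -` annulus_bdry R \<inter> space ?P)"
    unfolding bdry_measure_def
    by (rule emeasure_distr[OF polar_measurable[OF assms(1)]]) (metis sets.top space_bdry_measure sets_bdry_measure)
  also have "\<dots> = emeasure ?P (space ?P)"
    using measurable_space[OF polar_measurable[OF assms(1)]]
    by (intro arg_cong[where f = "emeasure ?P"]) (auto simp: space_restrict_space)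
  also have "\<dots> = emeasure (count_space {R, 1}) {R, 1} * 1"
    unfolding space_pair_measure using U.emeasure_space_1
    by (subst U.emeasure_pair_measure_Times) simp_all
  also have "\<dots> = 2" using assms by (subst emeasure_count_space) auto
  finally show ?thesis by simp
qed

lemma integral_bdry_measure:
  fixes u :: "complex \<Rightarrow> complex"
  assumes R: "0 \<le> R" "R < 1" and u: "integrable (bdry_measure R) u"
  shows "(LINT z|bdry_measure R. u z) =
    of_real (1 / (2 * pi)) * (LINT t:{0..2*pi}|lborel. u (cis t)) +
    of_real (1 / (2 * pi)) * (LINT t:{0..2*pi}|lborel. u (of_real R * cis t))"
proof -
  let ?U = "uniform_measure lborel {0..2*pi::real}"
  let ?c = "\<lambda>(r, t). of_real r * cis t :: complex"
  interpret U: prob_space ?U by (rule prob_space_uniform)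
  interpret F: finite_measure "count_space {R, 1}" by (rule finite_measure_count_space) simp
  interpret pair_sigma_finite "count_space {R, 1}" ?U ..
  have um: "u \<in> borel_measurable (restrict_space borel (annulus_bdry R))"
    using borel_measurable_integrable[OF u] by (simp add: measurable_cong_sets[OF sets_bdry_measure])
  have int: "integrable (count_space {R, 1} \<Otimes>\<^sub>M ?U) (\<lambda>x. u (?c x))"
    using u unfolding bdry_measure_def by (subst (asm) integrable_distr_eq) (use R um polar_measurable in auto)
  have "(LINT z|bdry_measure R. u z) = (LINT x|(count_space {R, 1} \<Otimes>\<^sub>M ?U). u (?c x))"
    unfolding bdry_measure_def by (rule integral_distr) (use R um polar_measurable in auto)
  also have "\<dots> = (LINT r|count_space {R, 1}. LINT t|?U. u (of_real r * cis t))"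
    using integral_fst'[OF int] by simp
  also have "\<dots> = (\<Sum>r\<in>{R, 1}. LINT t|?U. u (of_real r * cis t))"
    by (rule lebesgue_integral_count_space_finite) simp
  finally have *: "(LINT z|bdry_measure R. u z) =
    (LINT t|?U. u (cis t)) + (LINT t|?U. u (of_real R * cis t))" using R by simp
  have "(LINT t|?U. u (of_real r * cis t)) =
      of_real (1 / (2 * pi)) * (LINT t:{0..2*pi}|lborel. u (of_real r * cis t))"
    if r: "r \<in> {R, 1}" for r
  proof -
    have "(\<lambda>t. of_real r * cis t) \<in> borel \<rightarrow>\<^sub>M restrict_space borel (annulus_bdry R)"
      using r R by (intro measurable_restrict_space2 borel_measurable_continuous_onI continuous_intros)
        (auto simp: annulus_bdry_def norm_mult)
    then have m: "(\<lambda>t. u (of_real r * cis t)) \<in> borel_measurable lborel"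
      using measurable_compose um by fastforce
    have d: "?U = density lborel (\<lambda>t. ennreal (indicator {0..2*pi} t / (2*pi)))"
      unfolding uniform_measure_def
      by (intro density_cong) (auto simp: indicator_def divide_ennreal[symmetric])
    have "(LINT t|?U. u (of_real r * cis t)) =
        (LINT t|lborel. (indicator {0..2*pi} t / (2*pi)) *\<^sub>R u (of_real r * cis t))"
      unfolding d by (rule integral_density[OF m]) simp_all
    also have "\<dots> = (LINT t|lborel. of_real (1 / (2 * pi)) *
        (indicator {0..2*pi} t *\<^sub>R u (of_real r * cis t)))"
      by (intro Bochner_Integration.integral_cong) (simp_all add: scaleR_conv_of_real)
    finally show ?thesis by (simp only: integral_mult_right_zero set_lebesgue_integral_def)
  qed
  from this[of 1] this[of R] * show ?thesis by simp
qed

end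

theory Submission
  imports Defs "HOL-Computational_Algebra.Fundamental_Theorem_Algebra"
begin

text \<open>
  In the orthogonal basis \<open>z\<^sup>n\<close>, \<open>n \<in> \<int>\<close>, a Toeplitz operator on the annulus is a matrix whose
  entry from \<open>z\<^sup>n\<close> to \<open>z\<^sup>m\<close> is, up to the positive factor \<open>1 + R\<^sup>2\<^sup>m\<close> in the denominator,
  \<open>g\<^sub>k(1) + R\<^bsup>n+m\<^esup> g\<^sub>k(R)\<close> with \<open>k = m - n\<close>. If the Fourier coefficients of \<open>g\<close> vanish above the
  index \<open>b\<close>, then \<open>T\<^sub>g\<close> raises degrees by at most \<open>b\<close>; likewise \<open>T\<^sub>f\<close> raises them by at most \<open>a\<close>.
  Hence the coefficient of \<open>T\<^sub>f T\<^sub>g z\<^sup>n\<close> at the largest possible degree \<open>n + b + a\<close> is not a sum but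
  a single product, of the two numbers
  \<open>g\<^sub>b(1) + R\<^bsup>2n+b\<^esup> g\<^sub>b(R)\<close> and \<open>f\<^sub>a(1) + R\<^bsup>2(n+b)+a\<^esup> f\<^sub>a(R)\<close>, up to a nonzero constant.

  If neither \<open>f\<close> nor \<open>g\<close> vanishes almost everywhere, then \<open>a\<close> and \<open>b\<close> can be taken to be the largest
  indices at which a coefficient on one of the circles is nonzero (\<open>top_fourier_coeff\<close>). Since
  \<open>n \<mapsto> R\<^sup>2\<^sup>n\<close> is injective, each of the two factors then vanishes for at most one \<open>n\<close>
  (\<open>exponential_at_most_one_zero\<close>), so some \<open>n\<close> among any three gives a nonzero product, and
  \<open>T\<^sub>f T\<^sub>g \<noteq> 0\<close>.

  Three pieces of analysis turn this computation into a proof. The projection onto the Hardy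
  space exists, because \<open>L\<^sup>2\<close> is complete (\<open>l2_complete\<close>, \<open>l2_projection_exists\<close>). A bounded
  function with vanishing Fourier coefficients on both circles is zero almost everywhere
  (\<open>fourier_uniqueness\<close>, by the Stone-Weierstrass theorem). Laurent polynomials are dense in the
  Hardy space (\<open>hardy_approx_laurent\<close>), so that a Hardy function orthogonal to all \<open>z\<^sup>m\<close> with
  \<open>m \<ge> m\<^sub>0\<close> behaves like a function of degree below \<open>m\<^sub>0\<close>
  (\<open>hardy_orthogonal_of_low_degree\<close>); this replaces the infinite matrix product.
\<close>

section \<open>Square-integrable functions\<close>

definition l2_space :: "'a measure \<Rightarrow> ('a \<Rightarrow> complex) set" where
  "l2_space M = {f \<in> borel_measurable M. integrable M (\<lambda>x. (norm (f x))\<^sup>2)}"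

definition l2_inner :: "'a measure \<Rightarrow> ('a \<Rightarrow> complex) \<Rightarrow> ('a \<Rightarrow> complex) \<Rightarrow> complex" where
  "l2_inner M f g = (LINT x|M. f x * cnj (g x))"

definition l2_norm :: "'a measure \<Rightarrow> ('a \<Rightarrow> complex) \<Rightarrow> real" where
  "l2_norm M f = sqrt (LINT x|M. (norm (f x))\<^sup>2)"

lemma l2_space_measurable [measurable_dest]: "f \<in> l2_space M \<Longrightarrow> f \<in> borel_measurable M"
  by (simp add: l2_space_def)

lemma l2_norm_nonneg [simp]: "l2_norm M f \<ge> 0"
  by (simp add: l2_norm_def)

lemma l2_norm_sq: "(l2_norm M f)\<^sup>2 = (LINT x|M. (norm (f x))\<^sup>2)"
  by (simp add: l2_norm_def)

lemma borel_measurable_cnj [measurable]: "cnj \<in> borel_measurable borel"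
  by (intro borel_measurable_continuous_onI continuous_intros)

lemma l2_integrable_mult_cnj:
  assumes "f \<in> l2_space M" "g \<in> l2_space M"
  shows "integrable M (\<lambda>x. f x * cnj (g x))"
proof (rule Bochner_Integration.integrable_bound)
  show "integrable M (\<lambda>x. (norm (f x))\<^sup>2 + (norm (g x))\<^sup>2)"
    using assms by (simp add: l2_space_def)
  show "(\<lambda>x. f x * cnj (g x)) \<in> borel_measurable M"
    using assms by measurable
  have "norm a * norm b \<le> (norm a)\<^sup>2 + (norm b)\<^sup>2" for a b :: complex
    using sum_squares_bound[of "norm a" "norm b"] mult_nonneg_nonneg[OF norm_ge_zero norm_ge_zero, of a b] by linarith
  then show "AE x in M. norm (f x * cnj (g x)) \<le> norm ((norm (f x))\<^sup>2 + (norm (g x))\<^sup>2)"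
    by (simp add: norm_mult)
qed

lemma l2_space_cmult:
  assumes "f \<in> l2_space M"
  shows "(\<lambda>x. c * f x) \<in> l2_space M"
  using assms by (auto simp add: l2_space_def norm_mult power_mult_distrib)

lemma l2_space_add:
  assumes "f \<in> l2_space M" "g \<in> l2_space M"
  shows "(\<lambda>x. f x + g x) \<in> l2_space M"
proof -
  have "integrable M (\<lambda>x. (norm (f x + g x))\<^sup>2)"
  proof (rule Bochner_Integration.integrable_bound)
    show "integrable M (\<lambda>x. 2 * (norm (f x))\<^sup>2 + 2 * (norm (g x))\<^sup>2)"
      using assms by (simp add: l2_space_def)
    show "(\<lambda>x. (norm (f x + g x))\<^sup>2) \<in> borel_measurable M"
      using assms by measurable
    have "(norm (a + b))\<^sup>2 \<le> 2 * (norm a)\<^sup>2 + 2 * (norm b)\<^sup>2" for a b :: complex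
    proof -
      have "(norm (a + b))\<^sup>2 \<le> (norm a + norm b)\<^sup>2"
        by (simp add: norm_triangle_ineq power_mono)
      also have "\<dots> \<le> 2 * (norm a)\<^sup>2 + 2 * (norm b)\<^sup>2"
        using sum_squares_bound[of "norm a" "norm b"] by (simp add: power2_sum)
      finally show ?thesis .
    qed
    then show "AE x in M. norm ((norm (f x + g x))\<^sup>2) \<le> norm (2 * (norm (f x))\<^sup>2 + 2 * (norm (g x))\<^sup>2)"
      by simp
  qed
  then show ?thesis
    using assms by (auto simp: l2_space_def)
qed

lemma l2_space_diff:
  assumes "f \<in> l2_space M" "g \<in> l2_space M"
  shows "(\<lambda>x. f x - g x) \<in> l2_space M"
  using l2_space_add[OF assms(1) l2_space_cmult[OF assms(2), of "-1"]] by simp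

lemma l2_space_bounded_mult:
  assumes f: "f \<in> borel_measurable M" "AE x in M. norm (f x) \<le> B" and g: "g \<in> l2_space M"
  shows "(\<lambda>x. f x * g x) \<in> l2_space M" and "l2_norm M (\<lambda>x. f x * g x) \<le> \<bar>B\<bar> * l2_norm M g"
proof -
  have bd: "AE x in M. (norm (f x * g x))\<^sup>2 \<le> B\<^sup>2 * (norm (g x))\<^sup>2"
    using f(2) by eventually_elim (auto simp: norm_mult power_mult_distrib intro!: mult_right_mono power_mono)
  have int: "integrable M (\<lambda>x. B\<^sup>2 * (norm (g x))\<^sup>2)"
    using g by (simp add: l2_space_def)
  have int2: "integrable M (\<lambda>x. (norm (f x * g x))\<^sup>2)"
    by (rule Bochner_Integration.integrable_bound[OF int]) (use bd f g in auto)
  then show "(\<lambda>x. f x * g x) \<in> l2_space M"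
    using f g by (auto simp: l2_space_def)
  have "(LINT x|M. (norm (f x * g x))\<^sup>2) \<le> (LINT x|M. B\<^sup>2 * (norm (g x))\<^sup>2)"
    by (rule integral_mono_AE[OF int2 int bd])
  then have "(l2_norm M (\<lambda>x. f x * g x))\<^sup>2 \<le> (\<bar>B\<bar> * l2_norm M g)\<^sup>2"
    by (simp add: l2_norm_sq power_mult_distrib)
  then show "l2_norm M (\<lambda>x. f x * g x) \<le> \<bar>B\<bar> * l2_norm M g"
    by (rule power2_le_imp_le) simp
qed

lemma l2_inner_add_left:
  "\<lbrakk>f \<in> l2_space M; g \<in> l2_space M; h \<in> l2_space M\<rbrakk> \<Longrightarrow>
    l2_inner M (\<lambda>x. f x + g x) h = l2_inner M f h + l2_inner M g h"
  by (simp add: l2_inner_def ring_distribs l2_integrable_mult_cnj)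

lemma l2_inner_diff_left:
  "\<lbrakk>f \<in> l2_space M; g \<in> l2_space M; h \<in> l2_space M\<rbrakk> \<Longrightarrow>
    l2_inner M (\<lambda>x. f x - g x) h = l2_inner M f h - l2_inner M g h"
  by (simp add: l2_inner_def ring_distribs l2_integrable_mult_cnj)

lemma l2_inner_self: "l2_inner M f f = of_real ((l2_norm M f)\<^sup>2)"
  unfolding l2_inner_def l2_norm_sq complex_norm_square[symmetric] by (rule integral_complex_of_real)

lemma l2_inner_cmult_left: "l2_inner M (\<lambda>x. c * f x) h = c * l2_inner M f h"
  by (simp add: l2_inner_def mult.assoc)

lemma l2_inner_cmult_right: "l2_inner M f (\<lambda>x. c * h x) = cnj c * l2_inner M f h"
  unfolding l2_inner_def by (subst integral_mult_right_zero[symmetric]) (simp add: mult.left_commute)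

lemma l2_inner_commute: "l2_inner M g f = cnj (l2_inner M f g)"
  using Bochner_Integration.integral_cnj[of M "\<lambda>x. f x * cnj (g x)"] by (simp add: l2_inner_def mult.commute)

lemma l2_norm_add_sq:
  assumes "f \<in> l2_space M" "g \<in> l2_space M"
  shows "(l2_norm M (\<lambda>x. f x + g x))\<^sup>2 = (l2_norm M f)\<^sup>2 + 2 * Re (l2_inner M f g) + (l2_norm M g)\<^sup>2"
proof -
  have *: "(norm (a + b))\<^sup>2 = (norm a)\<^sup>2 + 2 * Re (a * cnj b) + (norm b)\<^sup>2" for a b :: complex
    by (simp add: cmod_power2 power2_sum algebra_simps)
  have "integrable M (\<lambda>x. Re (f x * cnj (g x)))"
    by (rule integrable_Re[OF l2_integrable_mult_cnj[OF assms]])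
  then show ?thesis
    unfolding l2_norm_sq * l2_inner_def
    using assms by (simp add: l2_space_def integral_Re[OF l2_integrable_mult_cnj[OF assms]] del: times_complex.sel)
qed

lemma l2_norm_cmult: "l2_norm M (\<lambda>x. c * f x) = norm c * l2_norm M f"
  by (simp add: l2_norm_def norm_mult power_mult_distrib real_sqrt_mult)

lemma l2_norm_minus_commute: "l2_norm M (\<lambda>x. f x - g x) = l2_norm M (\<lambda>x. g x - f x)"
  by (simp add: l2_norm_def norm_minus_commute)

text \<open>
  For \<open>G > 0\<close> the choice \<open>a = 1/G\<close>, the vertex of the quadratic in \<open>a\<close>, gives the bound; for
  \<open>G = 0\<close> the expression is linear in \<open>a\<close> and can stay nonnegative only if \<open>N = 0\<close>.
\<close>

lemma quadratic_nonneg_imp_le: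
  fixes d N G :: real
  assumes "G \<ge> 0" and nonneg: "\<And>a. 0 \<le> d - 2 * a * N + a\<^sup>2 * N * G"
  shows "N \<le> d * G"
proof (cases "G = 0")
  case True
  have "N = 0"
  proof (rule ccontr)
    assume "N \<noteq> 0"
    then show False
      using nonneg[of "(d + 1) / (2 * N)"] True by (simp add: field_simps)
  qed
  then show ?thesis using True by simp
next
  case False
  then have "G > 0" using assms by simp
  then show ?thesis
    using nonneg[of "1 / G"] by (simp add: field_simps power2_eq_square)
qed

text \<open>
  If \<open>\<parallel>f\<parallel>\<^sup>2\<close> exceeds a lower bound \<open>d\<close> of all \<open>\<parallel>f + t q\<parallel>\<^sup>2\<close> by \<open>\<delta>\<close>, then \<open>f\<close> is orthogonal to \<open>q\<close> up to
  an error \<open>\<surd>\<delta> \<parallel>q\<parallel>\<close>: moving \<open>t\<close> against the phase of \<open>\<langle>f, q\<rangle>\<close> would otherwise lower the norm too far. With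
  \<open>d = 0\<close> this is the Cauchy-Schwarz inequality, and along a minimizing sequence it yields the
  orthogonality that characterizes a projection.
\<close>

lemma l2_inner_bound_of_near_minimal:
  assumes f: "f \<in> l2_space M" and q: "q \<in> l2_space M"
    and min: "\<And>t. d \<le> (l2_norm M (\<lambda>x. f x + t * q x))\<^sup>2"
  shows "(norm (l2_inner M f q))\<^sup>2 \<le> ((l2_norm M f)\<^sup>2 - d) * (l2_norm M q)\<^sup>2"
proof (rule quadratic_nonneg_imp_le)
  fix a :: real
  let ?c = "l2_inner M f q"
  let ?t = "- of_real a * ?c"
  have 1: "l2_inner M f (\<lambda>x. ?t * q x) = cnj ?t * ?c"
    by (rule l2_inner_cmult_right)
  have 2: "cnj ?t * ?c = - of_real (a * (norm ?c)\<^sup>2)"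
    using complex_norm_square[of ?c] by (simp add: mult.assoc mult.commute)
  have "(l2_norm M (\<lambda>x. f x + ?t * q x))\<^sup>2 =
      (l2_norm M f)\<^sup>2 - 2 * a * (norm ?c)\<^sup>2 + a\<^sup>2 * (norm ?c)\<^sup>2 * (l2_norm M q)\<^sup>2"
    unfolding l2_norm_add_sq[OF f l2_space_cmult[OF q]] 1 2
    unfolding l2_norm_cmult by (simp add: norm_mult power_mult_distrib)
  then show "0 \<le> (l2_norm M f)\<^sup>2 - d - 2 * a * (norm ?c)\<^sup>2 + a\<^sup>2 * (norm ?c)\<^sup>2 * (l2_norm M q)\<^sup>2"
    using min[of ?t] by simp
qed simp

lemma l2_Cauchy_Schwarz:
  assumes "f \<in> l2_space M" "g \<in> l2_space M"
  shows "norm (l2_inner M f g) \<le> l2_norm M f * l2_norm M g"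
proof (rule power2_le_imp_le)
  have "(norm (l2_inner M f g))\<^sup>2 \<le> ((l2_norm M f)\<^sup>2 - 0) * (l2_norm M g)\<^sup>2"
    by (rule l2_inner_bound_of_near_minimal[OF assms]) simp
  then show "(norm (l2_inner M f g))\<^sup>2 \<le> (l2_norm M f * l2_norm M g)\<^sup>2"
    by (simp add: power_mult_distrib)
qed simp

lemma l2_norm_triangle:
  assumes "f \<in> l2_space M" "g \<in> l2_space M"
  shows "l2_norm M (\<lambda>x. f x + g x) \<le> l2_norm M f + l2_norm M g"
proof (rule power2_le_imp_le)
  have "Re (l2_inner M f g) \<le> l2_norm M f * l2_norm M g"
    using l2_Cauchy_Schwarz[OF assms] complex_Re_le_cmod order_trans by blast
  then show "(l2_norm M (\<lambda>x. f x + g x))\<^sup>2 \<le> (l2_norm M f + l2_norm M g)\<^sup>2"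
    by (simp add: l2_norm_add_sq[OF assms] power2_sum)
qed simp

lemma l2_norm_triangle_diff:
  assumes "f \<in> l2_space M" "g \<in> l2_space M" "h \<in> l2_space M"
  shows "l2_norm M (\<lambda>x. f x - h x) \<le> l2_norm M (\<lambda>x. f x - g x) + l2_norm M (\<lambda>x. g x - h x)"
  using l2_norm_triangle[OF l2_space_diff[OF assms(1,2)] l2_space_diff[OF assms(2,3)]] by simp

lemma l2_parallelogram:
  assumes "f \<in> l2_space M" "g \<in> l2_space M"
  shows "(l2_norm M (\<lambda>x. f x - g x))\<^sup>2 + (l2_norm M (\<lambda>x. f x + g x))\<^sup>2 = 2 * (l2_norm M f)\<^sup>2 + 2 * (l2_norm M g)\<^sup>2"
proof -
  have "(norm (a - b))\<^sup>2 + (norm (a + b))\<^sup>2 = 2 * (norm a)\<^sup>2 + 2 * (norm b)\<^sup>2" for a b :: complex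
    by (simp add: cmod_power2 power2_sum power2_diff algebra_simps)
  then have "(LINT x|M. (norm (f x - g x))\<^sup>2 + (norm (f x + g x))\<^sup>2) = (LINT x|M. 2 * (norm (f x))\<^sup>2 + 2 * (norm (g x))\<^sup>2)"
    by presburger
  then show ?thesis
    using assms l2_space_add[OF assms] l2_space_diff[OF assms]
    by (simp add: l2_norm_sq l2_space_def)
qed

lemma l2_norm_le_of_nn_integral:
  assumes [measurable]: "f \<in> borel_measurable M" and "(\<integral>\<^sup>+x. ennreal ((norm (f x))\<^sup>2) \<partial>M) \<le> ennreal (c\<^sup>2)" "c \<ge> 0"
  shows "f \<in> l2_space M" "l2_norm M f \<le> c"
proof -
  have "integrable M (\<lambda>x. (norm (f x))\<^sup>2)"
    using assms(2) by (intro integrableI_bounded) (auto simp: le_less_trans[OF _ ennreal_less_top])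
  then show "f \<in> l2_space M" by (simp add: l2_space_def)
  have "(l2_norm M f)\<^sup>2 \<le> c\<^sup>2"
    unfolding l2_norm_sq using assms(2)
    by (intro order_trans[OF eq_refl[OF integral_eq_nn_integral]] enn2real_leI) auto
  then show "l2_norm M f \<le> c" using assms(3) by (rule power2_le_imp_le)
qed

text \<open>
  The Riesz-Fischer theorem, for sequences with geometrically decreasing increments. On a finite
  measure space the increments are then summable in \<open>L\<^sup>1\<close>, hence absolutely summable at almost every
  point, which gives a pointwise limit; Fatou's lemma turns the bounds on \<open>\<parallel>h\<^sub>n - h\<^sub>n\<^sub>+\<^sub>k\<parallel>\<close> into bounds
  on the distance to that limit.
\<close>

lemma l2_complete:
  fixes h :: "nat \<Rightarrow> 'a \<Rightarrow> complex"
  assumes "finite_measure M" and h: "\<And>n. h n \<in> l2_space M"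
    and fast: "\<And>n. l2_norm M (\<lambda>x. h (Suc n) x - h n x) \<le> C * (1/2)^n"
  obtains p where "p \<in> l2_space M" "(\<lambda>n. l2_norm M (\<lambda>x. h n x - p x)) \<longlonglongrightarrow> 0"
proof -
  interpret finite_measure M by fact
  have [measurable]: "h n \<in> borel_measurable M" for n using h by (rule l2_space_measurable)
  have C: "C \<ge> 0" using order_trans[OF l2_norm_nonneg fast[of 0]] by simp
  define D where "D n x = norm (h (Suc n) x - h n x)" for n x
  have [measurable]: "D n \<in> borel_measurable M" for n unfolding D_def by measurable
  have one: "(\<lambda>_. 1) \<in> l2_space M" by (simp add: l2_space_def)
  have DL: "(\<lambda>x. complex_of_real (D n x)) \<in> l2_space M" for n
    using l2_space_diff[OF h[of "Suc n"] h[of n]] by (simp add: l2_space_def D_def)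
  have Dint: "integrable M (D n)" for n
    using integrable_Re[OF l2_integrable_mult_cnj[OF DL one, of n]] by simp
  have Dbd: "(LINT x|M. D n x) \<le> C * (1/2)^n * l2_norm M (\<lambda>_. 1)" for n
  proof -
    have "l2_inner M (\<lambda>x. complex_of_real (D n x)) (\<lambda>_. 1) = complex_of_real (LINT x|M. D n x)"
      by (simp add: l2_inner_def)
    then have "(LINT x|M. D n x) \<le> norm (l2_inner M (\<lambda>x. complex_of_real (D n x)) (\<lambda>_. 1))"
      by (simp only: norm_of_real abs_ge_self)
    also have "\<dots> \<le> l2_norm M (\<lambda>x. complex_of_real (D n x)) * l2_norm M (\<lambda>_. 1)"
      by (rule l2_Cauchy_Schwarz[OF DL one])
    also have "l2_norm M (\<lambda>x. complex_of_real (D n x)) = l2_norm M (\<lambda>x. h (Suc n) x - h n x)"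
      by (simp add: l2_norm_def D_def)
    finally show ?thesis using fast[of n] by (meson l2_norm_nonneg mult_right_mono order_trans)
  qed
  have "(\<integral>\<^sup>+x. (\<Sum>n. ennreal (D n x)) \<partial>M) = (\<Sum>n. \<integral>\<^sup>+x. ennreal (D n x) \<partial>M)"
    by (rule nn_integral_suminf) simp
  also have "\<dots> = (\<Sum>n. ennreal (LINT x|M. D n x))"
    using Dint by (subst nn_integral_eq_integral) (auto simp: D_def)
  also have "\<dots> \<le> (\<Sum>n. ennreal (C * (1/2)^n * l2_norm M (\<lambda>_. 1)))"
    by (intro suminf_le ennreal_leI Dbd) auto
  also have "\<dots> = ennreal (\<Sum>n. C * (1/2)^n * l2_norm M (\<lambda>_. 1))"
    using C by (intro suminf_ennreal2 summable_mult2 summable_mult summable_geometric) auto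
  also have "\<dots> < \<infinity>" by simp
  finally have "(\<integral>\<^sup>+x. (\<Sum>n. ennreal (D n x)) \<partial>M) \<noteq> \<infinity>" by simp
  then have "AE x in M. (\<Sum>n. ennreal (D n x)) \<noteq> \<infinity>"
    by (intro nn_integral_noteq_infinite) auto
  then have conv: "AE x in M. (\<lambda>n. h n x) \<longlonglongrightarrow> lim (\<lambda>n. h n x)"
  proof eventually_elim
    case (elim x)
    have "summable (\<lambda>n. norm (h (Suc n) x - h n x))"
      using elim by (intro summable_suminf_not_top) (auto simp: D_def)
    then have "summable (\<lambda>n. h (Suc n) x - h n x)" by (rule summable_norm_cancel)
    then have "convergent (\<lambda>n. \<Sum>i<n. h (Suc i) x - h i x)"
      by (simp add: summable_iff_convergent)
    then have "convergent (\<lambda>n. h n x - h 0 x)"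
      by (subst (asm) sum_lessThan_telescope[of "\<lambda>i. h i x"])
    then have "convergent (\<lambda>n. h n x)" by (subst (asm) convergent_diff_const_right_iff)
    then show ?case by (simp add: convergent_LIMSEQ_iff)
  qed
  define p where "p x = lim (\<lambda>n. h n x)" for x
  have [measurable]: "p \<in> borel_measurable M" unfolding p_def by measurable
  have tail: "l2_norm M (\<lambda>x. h n x - h (n + k) x) \<le> 2 * C * (1/2)^n * (1 - (1/2)^k)" for n k
  proof (induction k)
    case 0
    then show ?case by (simp add: l2_norm_def)
  next
    case (Suc k)
    have "l2_norm M (\<lambda>x. h n x - h (n + Suc k) x) \<le> l2_norm M (\<lambda>x. h n x - h (n + k) x) + l2_norm M (\<lambda>x. h (n + k) x - h (n + Suc k) x)"
      by (rule l2_norm_triangle_diff) (auto intro: h)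
    also have "\<dots> \<le> 2 * C * (1/2)^n * (1 - (1/2)^k) + C * (1/2)^(n+k)"
      using Suc fast[of "n + k"] by (subst (2) l2_norm_minus_commute) simp
    also have "\<dots> = 2 * C * (1/2)^n * (1 - (1/2)^(Suc k))"
      by (simp add: power_add algebra_simps)
    finally show ?case .
  qed
  have bd: "(\<lambda>x. h n x - p x) \<in> l2_space M \<and> l2_norm M (\<lambda>x. h n x - p x) \<le> 2 * C * (1/2)^n" for n
  proof -
    let ?c = "2 * C * (1/2)^n"
    have "(\<integral>\<^sup>+x. ennreal ((norm (h n x - p x))\<^sup>2) \<partial>M) = (\<integral>\<^sup>+x. liminf (\<lambda>k. ennreal ((norm (h n x - h (n + k) x))\<^sup>2)) \<partial>M)"
    proof (rule nn_integral_cong_AE, use conv in eventually_elim)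
      case (elim x)
      have "(\<lambda>k. h (n + k) x) \<longlonglongrightarrow> p x"
        using LIMSEQ_ignore_initial_segment[OF elim, of n] by (simp add: p_def add.commute)
      then have "(\<lambda>k. ennreal ((norm (h n x - h (n + k) x))\<^sup>2)) \<longlonglongrightarrow> ennreal ((norm (h n x - p x))\<^sup>2)"
        by (intro tendsto_intros)
      then show ?case by (rule lim_imp_Liminf[OF sequentially_bot, symmetric])
    qed
    also have "\<dots> \<le> liminf (\<lambda>k. \<integral>\<^sup>+x. ennreal ((norm (h n x - h (n + k) x))\<^sup>2) \<partial>M)"
      by (rule nn_integral_liminf) measurable
    also have "\<dots> \<le> liminf (\<lambda>k. ennreal (?c\<^sup>2))"
    proof (rule Liminf_mono, rule always_eventually, rule allI)
      fix k
      have "(\<integral>\<^sup>+x. ennreal ((norm (h n x - h (n + k) x))\<^sup>2) \<partial>M) = ennreal ((l2_norm M (\<lambda>x. h n x - h (n + k) x))\<^sup>2)"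
        unfolding l2_norm_sq using l2_space_diff[OF h h, of n "n + k"]
        by (intro nn_integral_eq_integral) (auto simp: l2_space_def)
      also have "\<dots> \<le> ennreal (?c\<^sup>2)"
      proof (intro ennreal_leI power_mono l2_norm_nonneg)
        have "?c * (1 - (1/2)^k) \<le> ?c" using C by (intro mult_left_le) auto
        then show "l2_norm M (\<lambda>x. h n x - h (n + k) x) \<le> ?c"
          using tail order_trans by blast
      qed
      finally show "(\<integral>\<^sup>+x. ennreal ((norm (h n x - h (n + k) x))\<^sup>2) \<partial>M) \<le> ennreal (?c\<^sup>2)" .
    qed
    also have "\<dots> = ennreal (?c\<^sup>2)" by (simp add: Liminf_const)
    finally show ?thesis
      using C l2_norm_le_of_nn_integral[of "\<lambda>x. h n x - p x" M ?c] by simp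
  qed
  show ?thesis
  proof
    show "p \<in> l2_space M" using l2_space_diff[OF h[of 0] conjunct1[OF bd[of 0]]] by simp
    show "(\<lambda>n. l2_norm M (\<lambda>x. h n x - p x)) \<longlonglongrightarrow> 0"
    proof (rule tendsto_sandwich[OF _ _ tendsto_const])
      show "(\<lambda>n. 2 * C * (1/2::real)^n) \<longlonglongrightarrow> 0"
        by (intro tendsto_mult_right_zero LIMSEQ_realpow_zero) auto
    qed (use bd in auto)
  qed
qed

text \<open>
  The parallelogram law, applied to two elements of \<open>H\<close> nearly closest to \<open>u\<close> and to their midpoint,
  shows that a minimizing sequence for the distance from \<open>u\<close> to \<open>H\<close> is Cauchy. Its limit is the
  projection.
\<close>

lemma l2_projection_exists:
  assumes M: "finite_measure M" and sub: "H \<subseteq> l2_space M" and zero: "(\<lambda>_. 0) \<in> H"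
    and lin: "\<And>h q c. h \<in> H \<Longrightarrow> q \<in> H \<Longrightarrow> (\<lambda>x. h x + c * q x) \<in> H"
    and closed: "\<And>p. p \<in> l2_space M \<Longrightarrow> (\<And>\<epsilon>. \<epsilon> > 0 \<Longrightarrow> \<exists>h\<in>H. l2_norm M (\<lambda>x. p x - h x) < \<epsilon>) \<Longrightarrow> p \<in> H"
    and u: "u \<in> l2_space M"
  obtains p where "p \<in> H" "\<And>q. q \<in> H \<Longrightarrow> l2_inner M (\<lambda>x. u x - p x) q = 0"
proof -
  define S where "S = (\<lambda>h. (l2_norm M (\<lambda>x. u x - h x))\<^sup>2) ` H"
  define d where "d = Inf S"
  have bdd: "bdd_below S" unfolding S_def by (rule bdd_belowI2[of _ 0]) simp
  have ge: "d \<le> (l2_norm M (\<lambda>x. u x - h x))\<^sup>2" if "h \<in> H" for h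
    unfolding d_def using that bdd by (intro cInf_lower) (auto simp: S_def)
  have "\<exists>h\<in>H. (l2_norm M (\<lambda>x. u x - h x))\<^sup>2 < d + e" if "e > 0" for e
    using cInf_lessD[of S "d + e"] that zero by (auto simp: d_def S_def)
  \<comment> \<open>The squared distance is within \<open>4\<^sup>-\<^sup>n\<close> of its infimum, so that consecutive terms are \<open>O(2\<^sup>-\<^sup>n)\<close> apart.\<close>
  then have "\<exists>h\<in>H. (l2_norm M (\<lambda>x. u x - h x))\<^sup>2 < d + (1/4)^n" for n by simp
  then obtain h where h: "\<And>n. h n \<in> H" and hd: "\<And>n. (l2_norm M (\<lambda>x. u x - h n x))\<^sup>2 < d + (1/4)^n"
    by metis
  have hL: "h n \<in> l2_space M" for n using h sub by auto
  have uh: "(\<lambda>x. u x - h n x) \<in> l2_space M" for n by (intro l2_space_diff u hL)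
  have fast: "l2_norm M (\<lambda>x. h (Suc n) x - h n x) \<le> 2 * (1/2)^n" for n
  proof (rule power2_le_imp_le)
    let ?m = "\<lambda>x. (0 + (1/2) * h n x) + (1/2) * h (Suc n) x"
    have "?m \<in> H" by (intro lin zero h)
    then have "d \<le> (l2_norm M (\<lambda>x. u x - ?m x))\<^sup>2" by (rule ge)
    also have "(\<lambda>x. u x - ?m x) = (\<lambda>x. (1/2) * ((u x - h n x) + (u x - h (Suc n) x)))"
      by (simp add: fun_eq_iff field_simps)
    also have "(l2_norm M \<dots>)\<^sup>2 = (l2_norm M (\<lambda>x. (u x - h n x) + (u x - h (Suc n) x)))\<^sup>2 / 4"
      unfolding l2_norm_cmult by (simp add: power_mult_distrib power2_eq_square)
    finally have "4 * d \<le> (l2_norm M (\<lambda>x. (u x - h n x) + (u x - h (Suc n) x)))\<^sup>2" by simp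
    moreover have "(\<lambda>x. (u x - h n x) - (u x - h (Suc n) x)) = (\<lambda>x. h (Suc n) x - h n x)"
      by (simp add: fun_eq_iff)
    ultimately have "(l2_norm M (\<lambda>x. h (Suc n) x - h n x))\<^sup>2 \<le>
        2 * (l2_norm M (\<lambda>x. u x - h n x))\<^sup>2 + 2 * (l2_norm M (\<lambda>x. u x - h (Suc n) x))\<^sup>2 - 4 * d"
      using l2_parallelogram[OF uh[of n] uh[of "Suc n"]] by simp
    also have "\<dots> \<le> 2 * (1/4)^n + 2 * (1/4)^(Suc n)" using hd[of n] hd[of "Suc n"] by linarith
    also have "\<dots> \<le> 4 * (1/4)^n" by simp
    also have "\<dots> = (2 * (1/2)^n)\<^sup>2"
    proof -
      have "((1/2::real)^n)\<^sup>2 = (1/4)^n"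
        by (simp add: power2_eq_square flip: power_mult_distrib)
      then show ?thesis by (simp add: power_mult_distrib)
    qed
    finally show "(l2_norm M (\<lambda>x. h (Suc n) x - h n x))\<^sup>2 \<le> (2 * (1/2)^n)\<^sup>2" .
  qed simp
  obtain p where p: "p \<in> l2_space M" and lim: "(\<lambda>n. l2_norm M (\<lambda>x. h n x - p x)) \<longlonglongrightarrow> 0"
    using l2_complete[OF M hL fast] .
  have pH: "p \<in> H"
  proof (rule closed[OF p])
    fix e :: real assume "e > 0"
    then have "\<forall>\<^sub>F n in sequentially. l2_norm M (\<lambda>x. h n x - p x) < e"
      using lim by (simp add: order_tendstoD(2))
    then show "\<exists>h\<in>H. l2_norm M (\<lambda>x. p x - h x) < e"
      using h by (subst l2_norm_minus_commute) (auto simp: eventually_sequentially)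
  qed
  show ?thesis
  proof
    show "p \<in> H" by fact
    fix q assume q: "q \<in> H"
    then have qL: "q \<in> l2_space M" using sub by auto
    have a: "(norm (l2_inner M (\<lambda>x. u x - h n x) q))\<^sup>2 \<le> (1/4)^n * (l2_norm M q)\<^sup>2" for n
    proof -
      have "(norm (l2_inner M (\<lambda>x. u x - h n x) q))\<^sup>2 \<le> ((l2_norm M (\<lambda>x. u x - h n x))\<^sup>2 - d) * (l2_norm M q)\<^sup>2"
      proof (rule l2_inner_bound_of_near_minimal[OF uh qL])
        fix t
        have "d \<le> (l2_norm M (\<lambda>x. u x - (h n x + (- t) * q x)))\<^sup>2"
          by (intro ge lin h q)
        then show "d \<le> (l2_norm M (\<lambda>x. u x - h n x + t * q x))\<^sup>2"
          by (simp add: algebra_simps)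
      qed
      also have "\<dots> \<le> (1/4)^n * (l2_norm M q)\<^sup>2"
        using hd[of n] by (intro mult_right_mono) auto
      finally show ?thesis .
    qed
    have "(\<lambda>n. (norm (l2_inner M (\<lambda>x. u x - h n x) q))\<^sup>2) \<longlonglongrightarrow> 0"
    proof (rule tendsto_sandwich[OF _ _ tendsto_const])
      show "(\<lambda>n. (1/4::real)^n * (l2_norm M q)\<^sup>2) \<longlonglongrightarrow> 0"
        by (intro tendsto_mult_left_zero LIMSEQ_realpow_zero) auto
    qed (use a in auto)
    then have l1: "(\<lambda>n. l2_inner M (\<lambda>x. u x - h n x) q) \<longlonglongrightarrow> 0"
      by (simp add: tendsto_norm_zero_iff)
    have l2: "(\<lambda>n. l2_inner M (\<lambda>x. h n x - p x) q) \<longlonglongrightarrow> 0"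
    proof (rule Lim_null_comparison)
      show "\<forall>\<^sub>F n in sequentially. norm (l2_inner M (\<lambda>x. h n x - p x) q) \<le> l2_norm M (\<lambda>x. h n x - p x) * l2_norm M q"
        by (intro always_eventually allI l2_Cauchy_Schwarz l2_space_diff hL p qL)
      show "(\<lambda>n. l2_norm M (\<lambda>x. h n x - p x) * l2_norm M q) \<longlonglongrightarrow> 0"
        using lim by (rule tendsto_mult_left_zero)
    qed
    have "l2_inner M (\<lambda>x. u x - p x) q = l2_inner M (\<lambda>x. u x - h n x) q + l2_inner M (\<lambda>x. h n x - p x) q" for n
      using l2_inner_add_left[OF uh[of n] l2_space_diff[OF hL[of n] p] qL] by simp
    then show "l2_inner M (\<lambda>x. u x - p x) q = 0"
      using tendsto_add[OF l1 l2] by (simp add: LIMSEQ_const_iff)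
  qed
qed

section \<open>Uniqueness of Fourier coefficients on the two circles\<close>

lemma finite_measure_bdry: "0 \<le> R \<Longrightarrow> R < 1 \<Longrightarrow> finite_measure (bdry_measure R)"
  by (rule finite_measureI) (simp add: emeasure_bdry_measure_space)

lemma compact_annulus_bdry: "compact (annulus_bdry R)"
  unfolding annulus_bdry_def by (intro compact_Un compact_sphere)

lemma borel_measurable_bdry_continuous_on:
  "continuous_on (annulus_bdry R) f \<Longrightarrow> f \<in> borel_measurable (bdry_measure R)"
  using borel_measurable_continuous_on_restrict[of "annulus_bdry R" f]
  by (simp add: measurable_cong_sets[OF sets_bdry_measure])

lemma Linf_bdry_measurable [measurable_dest]:
  "f \<in> Linf_bdry R \<Longrightarrow> f \<in> borel_measurable (bdry_measure R)"
  by (simp add: Linf_bdry_def)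

lemma continuous_on_imp_Linf_bdry:
  assumes "continuous_on (annulus_bdry R) f"
  shows "f \<in> Linf_bdry R"
proof -
  have "bounded (f ` annulus_bdry R)"
    by (intro compact_imp_bounded compact_continuous_image assms compact_annulus_bdry)
  then obtain B where "\<forall>z\<in>annulus_bdry R. norm (f z) \<le> B"
    by (auto simp: bounded_iff)
  then show ?thesis
    using borel_measurable_bdry_continuous_on[OF assms]
    by (auto simp: Linf_bdry_def intro!: exI[of _ B] AE_I2)
qed

lemma Linf_bdry_add:
  assumes "f \<in> Linf_bdry R" "g \<in> Linf_bdry R"
  shows "(\<lambda>z. f z + g z) \<in> Linf_bdry R"
proof -
  obtain B C where B: "AE z in bdry_measure R. norm (f z) \<le> B" and C: "AE z in bdry_measure R. norm (g z) \<le> C"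
    using assms by (auto simp: Linf_bdry_def)
  have "AE z in bdry_measure R. norm (f z + g z) \<le> B + C"
    using B C by eventually_elim (rule norm_triangle_mono)
  then show ?thesis using assms by (auto simp: Linf_bdry_def)
qed

lemma Linf_bdry_mult:
  assumes "f \<in> Linf_bdry R" "g \<in> Linf_bdry R"
  shows "(\<lambda>z. f z * g z) \<in> Linf_bdry R"
proof -
  obtain B C where B: "AE z in bdry_measure R. norm (f z) \<le> B" and C: "AE z in bdry_measure R. norm (g z) \<le> C"
    using assms by (auto simp: Linf_bdry_def)
  have "AE z in bdry_measure R. norm (f z * g z) \<le> B * C"
    using B C
  proof eventually_elim
    case (elim z)
    have "norm (f z) * norm (g z) \<le> B * C"
      using elim order_trans[OF norm_ge_zero elim(1)] by (intro mult_mono) auto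
    then show ?case by (simp add: norm_mult)
  qed
  then show ?thesis using assms by (auto simp: Linf_bdry_def)
qed

lemma Linf_bdry_cmult: "f \<in> Linf_bdry R \<Longrightarrow> (\<lambda>z. c * f z) \<in> Linf_bdry R"
  by (rule Linf_bdry_mult) (auto intro: continuous_on_imp_Linf_bdry)

lemma integrable_Linf_bdry:
  assumes "0 \<le> R" "R < 1" "f \<in> Linf_bdry R"
  shows "integrable (bdry_measure R) f"
proof -
  interpret finite_measure "bdry_measure R" by (rule finite_measure_bdry) fact+
  from assms(3) obtain B where "AE z in bdry_measure R. norm (f z) \<le> B"
    by (auto simp: Linf_bdry_def)
  then show ?thesis using assms(3) by (intro integrable_const_bound[of _ B]) auto
qed

lemma Linf_bdry_subset_l2:
  assumes "0 \<le> R" "R < 1" "f \<in> Linf_bdry R"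
  shows "f \<in> l2_space (bdry_measure R)"
proof -
  interpret finite_measure "bdry_measure R" by (rule finite_measure_bdry) fact+
  obtain B where B: "AE z in bdry_measure R. norm (f z) \<le> B"
    using assms by (auto simp: Linf_bdry_def)
  have "(\<lambda>z. f z * 1) \<in> l2_space (bdry_measure R)"
    by (rule l2_space_bounded_mult(1)[OF _ B]) (use assms in \<open>auto simp: l2_space_def\<close>)
  then show ?thesis by simp
qed

lemma nonzero_annulus_bdry: "0 < R \<Longrightarrow> z \<in> annulus_bdry R \<Longrightarrow> z \<noteq> 0"
  by (auto simp: annulus_bdry_def)

lemma continuous_on_powi_bdry [continuous_intros]:
  "0 < R \<Longrightarrow> continuous_on (annulus_bdry R) (\<lambda>z. z powi n)"
  by (intro continuous_intros) (auto dest: nonzero_annulus_bdry)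

lemma powi_Linf_bdry: "0 < R \<Longrightarrow> (\<lambda>z. z powi n) \<in> Linf_bdry R"
  by (intro continuous_on_imp_Linf_bdry continuous_intros)

lemma polar_powi_mult_cnj:
  assumes "r > 0"
  shows "(of_real r * cis t) powi n * cnj ((of_real r * cis t) powi m) =
    of_real (r powi (n + m)) * cis (- of_int (m - n) * t)"
proof -
  have "cis (of_int n * t) * cnj (cis (of_int m * t)) = cis (- of_int (m - n) * t)"
    by (simp add: cis_cnj cis_mult algebra_simps)
  then show ?thesis
    using assms by (simp add: power_int_mult_distrib power_int_add cis_power_int)
qed

text \<open>
  On the circle of radius \<open>r\<close> the function \<open>z\<^sup>n cnj(z\<^sup>m)\<close> is \<open>r\<^bsup>n+m\<^esup>\<close> times a character of index
  \<open>n - m\<close>. These are the unnormalized matrix entries of the Toeplitz operator with symbol \<open>u\<close>.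
\<close>

lemma bdry_moment:
  assumes R: "0 < R" "R < 1" and u: "u \<in> Linf_bdry R"
  shows "(LINT z|bdry_measure R. u z * z powi n * cnj (z powi m)) =
    fourier_coeff u 1 (m - n) + of_real (R powi (n + m)) * fourier_coeff u R (m - n)"
proof -
  have L: "(\<lambda>z. u z * z powi n * cnj (z powi m)) \<in> Linf_bdry R"
    using R by (intro Linf_bdry_mult u continuous_on_imp_Linf_bdry continuous_intros)
  have circle: "(LINT t:{0..2*pi}|lborel. u (of_real r * cis t) * (of_real r * cis t) powi n * cnj ((of_real r * cis t) powi m)) =
      of_real (r powi (n + m)) * (LINT t:{0..2*pi}|lborel. u (of_real r * cis t) * cis (- of_int (m - n) * t))"
    if "r > 0" for r
    unfolding mult.assoc polar_powi_mult_cnj[OF that]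
    by (subst set_integral_mult_right[symmetric]) (simp add: mult_ac)
  show ?thesis
    using circle[of 1] circle[of R] R integrable_Linf_bdry[OF _ _ L]
    by (simp add: integral_bdry_measure fourier_coeff_def)
qed

text \<open>
  Vanishing of all moments is inherited by \<open>z u\<close> and \<open>cnj z u\<close>, whose moments are again moments of
  \<open>u\<close>, and every real-linear function is a combination of \<open>z\<close> and \<open>cnj z\<close>. The
  induction over the polynomial treats all such \<open>u\<close> at once, so that it passes through products.
\<close>

lemma vanishing_moments_mult_real_polynomial:
  assumes R: "0 < R" "R < 1" and "real_polynomial_function \<phi>"
    and "u \<in> Linf_bdry R" "\<And>j k. (LINT z|bdry_measure R. u z * z ^ j * cnj z ^ k) = 0"
  shows "(\<lambda>z. u z * of_real (\<phi> z)) \<in> Linf_bdry R"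
    "(LINT z|bdry_measure R. u z * of_real (\<phi> z) * z ^ j * cnj z ^ k) = 0"
proof -
  define V where "V u \<longleftrightarrow> u \<in> Linf_bdry R \<and> (\<forall>j k. (LINT z|bdry_measure R. u z * z ^ j * cnj z ^ k) = 0)" for u
  have int: "integrable (bdry_measure R) (\<lambda>z. u z * z ^ j * cnj z ^ k)" if "V u" for u j k
  proof -
    have "u \<in> Linf_bdry R" using that by (simp add: V_def)
    then show ?thesis
      using R by (intro integrable_Linf_bdry Linf_bdry_mult[OF Linf_bdry_mult]) (auto intro!: continuous_on_imp_Linf_bdry continuous_intros)
  qed
  have V_add: "V (\<lambda>z. u z + v z)" if "V u" "V v" for u v
    using that int[OF that(1)] int[OF that(2)] by (simp add: V_def Linf_bdry_add ring_distribs)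
  have cmult: "V (\<lambda>z. c * u z)" if "V u" for u c
    using that by (simp add: V_def Linf_bdry_cmult mult.assoc)
  have Z: "V (\<lambda>z. u z * z)" if "V u" for u
  proof -
    have "(LINT z|bdry_measure R. u z * z * z ^ j * cnj z ^ k) = 0" for j k
      using that unfolding V_def by (metis (no_types, lifting) mult.assoc power_Suc Bochner_Integration.integral_cong)
    moreover have "(\<lambda>z. u z * z) \<in> Linf_bdry R"
      using that unfolding V_def by (intro Linf_bdry_mult) (auto intro!: continuous_on_imp_Linf_bdry continuous_intros)
    ultimately show ?thesis by (simp add: V_def)
  qed
  have Zc: "V (\<lambda>z. u z * cnj z)" if "V u" for u
  proof -
    have "u z * cnj z * z ^ j * cnj z ^ k = u z * z ^ j * cnj z ^ (Suc k)" for z j k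
      by (simp add: mult_ac)
    then have "(LINT z|bdry_measure R. u z * cnj z * z ^ j * cnj z ^ k) = 0" for j k
      using that unfolding V_def by presburger
    moreover have "(\<lambda>z. u z * cnj z) \<in> Linf_bdry R"
      using that unfolding V_def by (intro Linf_bdry_mult) (auto intro!: continuous_on_imp_Linf_bdry continuous_intros)
    ultimately show ?thesis by (simp add: V_def)
  qed
  have "V u \<Longrightarrow> V (\<lambda>z. u z * of_real (\<phi> z))" for u
    using assms(3)
  proof (induction arbitrary: u rule: real_polynomial_function.induct)
    case (linear \<phi>)
    then have u: "V u" and bl: "bounded_linear \<phi>" by auto
    interpret bounded_linear \<phi> by (rule bl)
    define \<alpha> where "\<alpha> = (of_real (\<phi> 1) - \<i> * of_real (\<phi> \<i>)) / 2"
    define \<beta> where "\<beta> = (of_real (\<phi> 1) + \<i> * of_real (\<phi> \<i>)) / 2"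
    have "of_real (\<phi> z) = \<alpha> * z + \<beta> * cnj z" for z
    proof -
      have "\<phi> z = \<phi> (Re z *\<^sub>R 1 + Im z *\<^sub>R \<i>)"
        by (rule arg_cong[where f = \<phi>]) (simp add: complex_eq_iff)
      also have "\<dots> = Re z * \<phi> 1 + Im z * \<phi> \<i>" by (simp only: add scaleR real_scaleR_def)
      finally show ?thesis
        by (simp add: complex_eq_iff \<alpha>_def \<beta>_def field_simps)
    qed
    then have "u z * of_real (\<phi> z) = \<alpha> * (u z * z) + \<beta> * (u z * cnj z)" for z
      by (simp add: algebra_simps)
    then show ?case using V_add[OF cmult[OF Z[OF u]] cmult[OF Zc[OF u]]] by simp
  next
    case (const c)
    then show ?case using cmult[of u "of_real c"] by (simp add: mult.commute)
  next
    case (add f g)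
    then show ?case using V_add[OF add.IH] by (simp add: ring_distribs)
  next
    case (mult f g)
    then show ?case using mult.IH(2)[OF mult.IH(1)[OF mult.prems]] by (simp add: mult.assoc)
  qed
  then show "(\<lambda>z. u z * of_real (\<phi> z)) \<in> Linf_bdry R"
    "(LINT z|bdry_measure R. u z * of_real (\<phi> z) * z ^ j * cnj z ^ k) = 0"
    using assms(4,5) by (auto simp: V_def)
qed

lemma vanishing_moments_imp_orthogonal_continuous:
  fixes \<phi> :: "complex \<Rightarrow> real"
  assumes R: "0 < R" "R < 1" and u: "u \<in> Linf_bdry R"
    and moments: "\<And>j k. (LINT z|bdry_measure R. u z * z ^ j * cnj z ^ k) = 0"
    and \<phi>: "continuous_on (annulus_bdry R) \<phi>"
  shows "(LINT z|bdry_measure R. u z * of_real (\<phi> z)) = 0"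
proof -
  let ?M = "bdry_measure R"
  let ?I = "LINT z|?M. norm (u z)"
  have ui: "integrable ?M u" using integrable_Linf_bdry[OF _ _ u] R by simp
  have "norm (LINT z|?M. u z * of_real (\<phi> z)) \<le> e * ?I" if "e > 0" for e
  proof -
    obtain p where p: "real_polynomial_function p" and close: "\<And>z. z \<in> annulus_bdry R \<Longrightarrow> \<bar>\<phi> z - p z\<bar> < e"
      using Stone_Weierstrass_real_polynomial_function[OF compact_annulus_bdry \<phi> \<open>e > 0\<close>] by blast
    have i1: "integrable ?M (\<lambda>z. u z * of_real (\<phi> z))"
      using R by (intro integrable_Linf_bdry Linf_bdry_mult u continuous_on_imp_Linf_bdry continuous_intros \<phi>) auto
    have i2: "integrable ?M (\<lambda>z. u z * of_real (p z))"
      using R vanishing_moments_mult_real_polynomial(1)[OF R p u moments]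
      by (intro integrable_Linf_bdry) auto
    have "(LINT z|?M. u z * of_real (p z)) = 0"
      using vanishing_moments_mult_real_polynomial(2)[OF R p u moments, of 0 0] by simp
    then have "(LINT z|?M. u z * of_real (\<phi> z)) = (LINT z|?M. u z * of_real (\<phi> z) - u z * of_real (p z))"
      using i1 i2 by simp
    also have "norm \<dots> \<le> (LINT z|?M. e * norm (u z))"
    proof (rule Bochner_Integration.integral_norm_bound_integral)
      fix z assume "z \<in> space ?M"
      then have "\<bar>\<phi> z - p z\<bar> \<le> e" using close[of z] by simp
      then have "\<bar>\<phi> z - p z\<bar> * norm (u z) \<le> e * norm (u z)" by (rule mult_right_mono) simp
      moreover have "u z * of_real (\<phi> z) - u z * of_real (p z) = of_real (\<phi> z - p z) * u z"
        by (simp add: algebra_simps)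
      ultimately show "norm (u z * of_real (\<phi> z) - u z * of_real (p z)) \<le> e * norm (u z)"
        by (simp only: norm_mult norm_of_real)
    qed (use i1 i2 ui in auto)
    finally show ?thesis by simp
  qed
  then have *: "norm (LINT z|?M. u z * of_real (\<phi> z)) \<le> e * ?I" if "e > 0" for e using that by blast
  have "?I \<ge> 0" by simp
  have "norm (LINT z|?M. u z * of_real (\<phi> z)) \<le> 0"
  proof (rule field_le_epsilon)
    fix e :: real assume "e > 0"
    have "e * (a / (a + 1)) \<le> e" if "a \<ge> 0" for a
      using \<open>e > 0\<close> that by (intro mult_left_le) auto
    from this[OF \<open>?I \<ge> 0\<close>] have "e / (?I + 1) * ?I \<le> e" by simp
    moreover have "e / (?I + 1) > 0" by (intro divide_pos_pos add_nonneg_pos \<open>e > 0\<close> \<open>?I \<ge> 0\<close> zero_less_one)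
    ultimately show "norm (LINT z|?M. u z * of_real (\<phi> z)) \<le> 0 + e"
      using *[of "e / (?I + 1)"] by linarith
  qed
  then show ?thesis by simp
qed

text \<open>
  Continuous functions \<open>max 0 (1 - n dist(z, A))\<close> decrease to the indicator of a closed set \<open>A\<close>, so
  the integral of \<open>u\<close> over closed sets is zero; since these sets generate the Borel sets and are
  stable under intersection, it is zero over every measurable set.
\<close>

lemma vanishing_moments_imp_zero:
  assumes R: "0 < R" "R < 1" and u: "u \<in> Linf_bdry R"
    and moments: "\<And>j k. (LINT z|bdry_measure R. u z * z ^ j * cnj z ^ k) = 0"
  shows "AE z in bdry_measure R. u z = 0"
proof -
  let ?M = "bdry_measure R"
  interpret finite_measure ?M using finite_measure_bdry R by simp
  have [measurable]: "u \<in> borel_measurable ?M" using u by measurable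
  have ui: "integrable ?M u" using integrable_Linf_bdry[OF _ _ u] R by simp
  have sets_iff: "A \<in> sets ?M \<longleftrightarrow> (\<exists>B\<in>sets borel. A = annulus_bdry R \<inter> B)" for A
    by (auto simp: sets_bdry_measure sets_restrict_space image_iff)
  have sub: "annulus_bdry R \<inter> B \<in> sets ?M" if "B \<in> sets borel" for B
    using that sets_iff by blast
  have ind_int: "integrable ?M (\<lambda>z. indicator B z *\<^sub>R u z)" if "B \<in> sets borel" for B
  proof -
    have "integrable ?M (\<lambda>z. indicator (annulus_bdry R \<inter> B) z *\<^sub>R u z)"
      by (rule integrable_mult_indicator[OF sub[OF that] ui])
    then show ?thesis
      by (rule Bochner_Integration.integrable_cong[OF refl, THEN iffD1, rotated]) (auto simp: indicator_def)
  qed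
  have closed: "(LINT z|?M. indicator A z *\<^sub>R u z) = 0" if "closed A" for A
  proof (cases "A = {}")
    case False
    define \<phi> where "\<phi> n z = max 0 (1 - real n * infdist z A)" for n z
    have lim: "(\<lambda>n. \<phi> n z) \<longlonglongrightarrow> indicator A z" for z
    proof (cases "z \<in> A")
      case False
      then have pos: "infdist z A > 0" using infdist_pos_not_in_closed that \<open>A \<noteq> {}\<close> by blast
      obtain n0 where n0: "1 < real n0 * infdist z A" using reals_Archimedean3[OF pos] by blast
      have "\<phi> n z = 0" if "n \<ge> n0" for n
      proof -
        have "real n0 * infdist z A \<le> real n * infdist z A" using that pos by (intro mult_right_mono) auto
        then show ?thesis using n0 by (simp add: \<phi>_def)
      qed
      then have "\<forall>\<^sub>F n in sequentially. \<phi> n z = 0" by (auto simp: eventually_sequentially)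
      then show ?thesis using False by (simp add: tendsto_eventually)
    qed (simp add: \<phi>_def)
    have "(\<lambda>n. LINT z|?M. u z * of_real (\<phi> n z)) \<longlonglongrightarrow> (LINT z|?M. indicator A z *\<^sub>R u z)"
    proof (rule integral_dominated_convergence[where w = "\<lambda>z. norm (u z)"])
      show "(\<lambda>z. indicator A z *\<^sub>R u z) \<in> borel_measurable ?M"
        using ind_int[of A] that by (auto dest: borel_measurable_integrable)
      show "(\<lambda>z. u z * of_real (\<phi> n z)) \<in> borel_measurable ?M" for n
      proof -
        have [measurable]: "\<phi> n \<in> borel_measurable ?M"
          unfolding \<phi>_def by (intro borel_measurable_bdry_continuous_on continuous_intros)
        show ?thesis by measurable
      qed
      show "integrable ?M (\<lambda>z. norm (u z))" using ui by simp
      show "AE z in ?M. (\<lambda>n. u z * of_real (\<phi> n z)) \<longlonglongrightarrow> indicator A z *\<^sub>R u z"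
        unfolding scaleR_conv_of_real mult.commute[of _ "u _"]
        by (intro AE_I2 tendsto_mult tendsto_const tendsto_of_real lim)
      show "AE z in ?M. norm (u z * of_real (\<phi> n z)) \<le> norm (u z)" for n
      proof (rule AE_I2)
        fix z
        have "\<bar>\<phi> n z\<bar> \<le> 1" using infdist_nonneg[of z A] by (simp add: \<phi>_def)
        then show "norm (u z * of_real (\<phi> n z)) \<le> norm (u z)"
          by (simp add: norm_mult mult_left_le)
      qed
    qed
    moreover have "(LINT z|?M. u z * of_real (\<phi> n z)) = 0" for n
      unfolding \<phi>_def
      by (intro vanishing_moments_imp_orthogonal_continuous R u moments continuous_intros)
    ultimately show ?thesis by (simp add: LIMSEQ_const_iff)
  qed simp
  have "(LINT z|?M. indicator B z *\<^sub>R u z) = 0" if "B \<in> sigma_sets UNIV (Collect closed)" for B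
  proof (rule sigma_sets_induct_disjoint[OF _ _ that,
      where P = "\<lambda>B. (LINT z|?M. indicator B z *\<^sub>R u z) = 0"])
    show "Int_stable (Collect closed)" by (auto simp: Int_stable_def)
    show "Collect closed \<subseteq> Pow UNIV" by simp
  next
    fix A :: "complex set" assume "A \<in> Collect closed"
    then show "(LINT z|?M. indicator A z *\<^sub>R u z) = 0" by (simp add: closed)
  next
    show "(LINT z|?M. indicator {} z *\<^sub>R u z) = 0" by simp
  next
    fix A :: "complex set" assume A: "A \<in> sigma_sets UNIV (Collect closed)" "(LINT z|?M. indicator A z *\<^sub>R u z) = 0"
    have Ab: "A \<in> sets borel" using A by (simp add: borel_eq_closed)
    have "indicator (UNIV - A) z *\<^sub>R u z = u z - indicator A z *\<^sub>R u z" for z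
      by (simp add: indicator_def)
    then show "(LINT z|?M. indicator (UNIV - A) z *\<^sub>R u z) = 0"
      using A(2) closed[of UNIV] ind_int[OF Ab] ui by simp
  next
    fix A :: "nat \<Rightarrow> complex set"
    assume disj: "disjoint_family A" and ran: "range A \<subseteq> sigma_sets UNIV (Collect closed)"
      and z: "\<And>i. (LINT z|?M. indicator (A i) z *\<^sub>R u z) = 0"
    have Ab: "A i \<in> sets borel" for i using ran by (auto simp: borel_eq_closed)
    have eq: "(LINT z:annulus_bdry R \<inter> B|?M. u z) = (LINT z|?M. indicator B z *\<^sub>R u z)" for B
      unfolding set_lebesgue_integral_def
      by (rule Bochner_Integration.integral_cong) (auto simp: indicator_def)
    have "(LINT z:(\<Union>i. annulus_bdry R \<inter> A i)|?M. u z) = (\<Sum>i. LINT z:annulus_bdry R \<inter> A i|?M. u z)"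
    proof (rule lebesgue_integral_countable_add)
      show "set_integrable ?M (\<Union>i. annulus_bdry R \<inter> A i) u"
        unfolding set_integrable_def using sub[OF Ab] ui by (intro integrable_mult_indicator sets.countable_UN) auto
    qed (use disj sub[OF Ab] in \<open>auto simp: disjoint_family_on_def\<close>)
    then show "(LINT z|?M. indicator (\<Union>i. A i) z *\<^sub>R u z) = 0"
      using z unfolding Int_UN_distrib[symmetric] eq by simp
  qed
  then have borel_zero: "(LINT z|?M. indicator B z *\<^sub>R u z) = 0" if "B \<in> sets borel" for B
    using that by (simp add: borel_eq_closed)
  have "(LINT z:A|?M. u z) = 0" if A: "A \<in> sets ?M" for A
  proof -
    obtain B where B: "B \<in> sets borel" "A = annulus_bdry R \<inter> B" using iffD1[OF sets_iff A] by blast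
    have "(LINT z:A|?M. u z) = (LINT z|?M. indicator B z *\<^sub>R u z)"
      unfolding set_lebesgue_integral_def B(2)
      by (rule Bochner_Integration.integral_cong) (auto simp: indicator_def)
    then show ?thesis using borel_zero[OF B(1)] by simp
  qed
  then show ?thesis by (rule density_zero[OF ui])
qed

lemma fourier_uniqueness:
  assumes R: "0 < R" "R < 1" and u: "u \<in> Linf_bdry R"
    and zero: "\<And>r k. r \<in> {R, 1} \<Longrightarrow> fourier_coeff u r k = 0"
  shows "AE z in bdry_measure R. u z = 0"
proof (rule vanishing_moments_imp_zero[OF R u])
  fix j k
  show "(LINT z|bdry_measure R. u z * z ^ j * cnj z ^ k) = 0"
    using bdry_moment[OF R u, of "int j" "int k"] zero by simp
qed

section \<open>Uniform approximation by Laurent polynomials\<close>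

text \<open>
  Laurent polynomials; the set of allowed exponents is a parameter so that a polynomial can be cut
  at a given degree into two parts orthogonal to each other.
\<close>

inductive_set laurent :: "int set \<Rightarrow> (complex \<Rightarrow> complex) set" for K where
  monom: "k \<in> K \<Longrightarrow> (\<lambda>z. c * z powi k) \<in> laurent K"
| add: "f \<in> laurent K \<Longrightarrow> g \<in> laurent K \<Longrightarrow> (\<lambda>z. f z + g z) \<in> laurent K"

lemma laurent_Linf_bdry: "\<psi> \<in> laurent K \<Longrightarrow> 0 < R \<Longrightarrow> \<psi> \<in> Linf_bdry R"
  by (induction rule: laurent.induct) (auto intro: Linf_bdry_cmult powi_Linf_bdry Linf_bdry_add)

lemma laurent_split:
  assumes "\<psi> \<in> laurent UNIV"
  shows "\<exists>lo\<in>laurent {..<m}. \<exists>hi\<in>laurent {m..}. \<forall>z. \<psi> z = lo z + hi z"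
  using assms
proof induction
  case (monom k c)
  have 0: "(\<lambda>z. 0 * z powi (m - 1)) \<in> laurent {..<m}" "(\<lambda>z. 0 * z powi m) \<in> laurent {m..}"
    by (rule laurent.monom; simp)+
  show ?case
  proof (cases "k < m")
    case True
    then have "(\<lambda>z. c * z powi k) \<in> laurent {..<m}" by (simp add: laurent.monom)
    then show ?thesis using 0(2) by force
  next
    case False
    then have "(\<lambda>z. c * z powi k) \<in> laurent {m..}" by (simp add: laurent.monom)
    then show ?thesis using 0(1) by force
  qed
next
  case (add f g)
  then obtain lf hf lg hg where
    "lf \<in> laurent {..<m}" "hf \<in> laurent {m..}" "\<forall>z. f z = lf z + hf z"
    "lg \<in> laurent {..<m}" "hg \<in> laurent {m..}" "\<forall>z. g z = lg z + hg z" by blast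
  then show ?case
    by (intro bexI[of _ "\<lambda>z. lf z + lg z"] bexI[of _ "\<lambda>z. hf z + hg z"] laurent.add) auto
qed

definition laurent_approximable :: "complex set \<Rightarrow> (complex \<Rightarrow> complex) \<Rightarrow> bool" where
  "laurent_approximable S \<phi> \<longleftrightarrow> (\<forall>\<epsilon>>0. \<exists>\<psi>\<in>laurent UNIV. \<forall>z\<in>S. norm (\<phi> z - \<psi> z) \<le> \<epsilon>)"

lemma laurent_approximable_limit:
  assumes "\<And>\<epsilon>. \<epsilon> > 0 \<Longrightarrow> \<exists>\<psi>. laurent_approximable S \<psi> \<and> (\<forall>z\<in>S. norm (\<phi> z - \<psi> z) \<le> \<epsilon>)"
  shows "laurent_approximable S \<phi>"
  unfolding laurent_approximable_def
proof (intro allI impI)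
  fix e :: real assume "e > 0"
  then obtain \<psi> where \<psi>: "laurent_approximable S \<psi>" "\<forall>z\<in>S. norm (\<phi> z - \<psi> z) \<le> e/2"
    using assms[of "e/2"] by auto
  then obtain \<xi> where "\<xi> \<in> laurent UNIV" "\<forall>z\<in>S. norm (\<psi> z - \<xi> z) \<le> e/2"
    using \<open>e > 0\<close> unfolding laurent_approximable_def by (meson half_gt_zero)
  moreover have "norm (\<phi> z - \<xi> z) \<le> e" if "norm (\<phi> z - \<psi> z) \<le> e/2" "norm (\<psi> z - \<xi> z) \<le> e/2" for z
    using norm_triangle_le[of "\<phi> z - \<psi> z" "\<psi> z - \<xi> z" e] that by simp
  ultimately show "\<exists>\<psi>\<in>laurent UNIV. \<forall>z\<in>S. norm (\<phi> z - \<psi> z) \<le> e" using \<psi> by blast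
qed

lemma laurent_approximable_laurent: "\<phi> \<in> laurent UNIV \<Longrightarrow> laurent_approximable S \<phi>"
  unfolding laurent_approximable_def by (auto intro!: bexI[of _ \<phi>])

lemma laurent_approximable_powi: "laurent_approximable S (\<lambda>z. c * z powi k)"
  by (intro laurent_approximable_laurent laurent.monom) simp

lemma laurent_approximable_cong:
  "laurent_approximable S \<phi> \<Longrightarrow> (\<And>z. z \<in> S \<Longrightarrow> \<phi> z = \<psi> z) \<Longrightarrow> laurent_approximable S \<psi>"
  unfolding laurent_approximable_def by simp

lemma laurent_approximable_const: "laurent_approximable S (\<lambda>z. c)"
  using laurent_approximable_powi[of S c 0] by simp

lemma laurent_approximable_add:
  assumes "laurent_approximable S f" "laurent_approximable S g"
  shows "laurent_approximable S (\<lambda>z. f z + g z)"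
  unfolding laurent_approximable_def
proof (intro allI impI)
  fix e :: real assume "e > 0"
  then have "e/2 > 0" by simp
  then obtain \<psi> \<xi> where *: "\<psi> \<in> laurent UNIV" "\<forall>z\<in>S. norm (f z - \<psi> z) \<le> e/2"
    "\<xi> \<in> laurent UNIV" "\<forall>z\<in>S. norm (g z - \<xi> z) \<le> e/2"
    using assms unfolding laurent_approximable_def by meson
  show "\<exists>\<psi>\<in>laurent UNIV. \<forall>z\<in>S. norm (f z + g z - \<psi> z) \<le> e"
  proof (intro bexI[of _ "\<lambda>z. \<psi> z + \<xi> z"] ballI laurent.add)
    fix z assume "z \<in> S"
    then show "norm (f z + g z - (\<psi> z + \<xi> z)) \<le> e"
      using * norm_triangle_le[of "f z - \<psi> z" "g z - \<xi> z" e] by (force simp: algebra_simps)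
  qed (use * in auto)
qed

lemma laurent_approximable_mult_powi:
  assumes "0 \<notin> S" "\<And>k. bounded ((\<lambda>z. z powi k) ` S)" and f: "laurent_approximable S f"
  shows "laurent_approximable S (\<lambda>z. c * z powi k * f z)"
  unfolding laurent_approximable_def
proof (intro allI impI)
  fix e :: real assume "e > 0"
  obtain B where B: "\<forall>z\<in>S. norm (z powi k) \<le> B" using assms(2)[of k] by (auto simp: bounded_iff)
  define D where "D = norm c * \<bar>B\<bar> + 1"
  have D: "D > 0" by (simp add: D_def add_nonneg_pos)
  then obtain \<psi> where \<psi>: "\<psi> \<in> laurent UNIV" "\<forall>z\<in>S. norm (f z - \<psi> z) \<le> e / D"
    using f \<open>e > 0\<close> unfolding laurent_approximable_def by (meson divide_pos_pos)
  have "\<exists>\<xi>\<in>laurent UNIV. \<forall>z\<in>S. \<xi> z = c * z powi k * \<psi> z"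
    using \<psi>(1)
  proof induction
    case (monom j d)
    have "(\<lambda>z. (c * d) * z powi (k + j)) \<in> laurent UNIV" by (rule laurent.monom) simp
    moreover have "(c * d) * z powi (k + j) = c * z powi k * (d * z powi j)" if "z \<in> S" for z
      using assms(1) that by (subst power_int_add) auto
    ultimately show ?case
      by (intro bexI[of _ "\<lambda>z. (c * d) * z powi (k + j)"] ballI)
  next
    case (add f g)
    then obtain \<xi>1 \<xi>2 where "\<xi>1 \<in> laurent UNIV" "\<forall>z\<in>S. \<xi>1 z = c * z powi k * f z"
      "\<xi>2 \<in> laurent UNIV" "\<forall>z\<in>S. \<xi>2 z = c * z powi k * g z" by blast
    then show ?case by (intro bexI[of _ "\<lambda>z. \<xi>1 z + \<xi>2 z"] laurent.add) (auto simp: ring_distribs)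
  qed
  then obtain \<xi> where \<xi>: "\<xi> \<in> laurent UNIV" "\<forall>z\<in>S. \<xi> z = c * z powi k * \<psi> z" by blast
  show "\<exists>\<psi>\<in>laurent UNIV. \<forall>z\<in>S. norm (c * z powi k * f z - \<psi> z) \<le> e"
  proof (intro bexI[OF _ \<xi>(1)] ballI)
    fix z assume z: "z \<in> S"
    have "c * z powi k * f z - \<xi> z = (c * z powi k) * (f z - \<psi> z)"
      using z \<xi>(2) by (simp add: algebra_simps)
    also have "norm \<dots> = norm (c * z powi k) * norm (f z - \<psi> z)" by (rule norm_mult)
    also have "\<dots> \<le> D * (e / D)"
    proof (intro mult_mono)
      have "norm (z powi k) \<le> \<bar>B\<bar>" using B z by force
      then have "norm c * norm (z powi k) \<le> norm c * \<bar>B\<bar>" by (intro mult_left_mono) auto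
      then show "norm (c * z powi k) \<le> D" by (simp add: D_def norm_mult)
    qed (use \<psi>(2) z D in auto)
    finally show "norm (c * z powi k * f z - \<xi> z) \<le> e" using D by simp
  qed
qed

lemma laurent_approximable_mult:
  assumes S: "0 \<notin> S" "\<And>k. bounded ((\<lambda>z. z powi k) ` S)"
    and f: "laurent_approximable S f" and g: "laurent_approximable S g" and bg: "bounded (g ` S)"
  shows "laurent_approximable S (\<lambda>z. f z * g z)"
proof (rule laurent_approximable_limit)
  fix e :: real assume "e > 0"
  obtain B where B: "\<forall>z\<in>S. norm (g z) \<le> B" "B > 0"
    using bg by (auto simp: bounded_pos)
  then obtain \<psi> where \<psi>: "\<psi> \<in> laurent UNIV" "\<forall>z\<in>S. norm (f z - \<psi> z) \<le> e / B"
    using f \<open>e > 0\<close> unfolding laurent_approximable_def by (meson divide_pos_pos)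
  have "laurent_approximable S (\<lambda>z. \<psi> z * g z)"
    using \<psi>(1)
  proof induction
    case (monom k c)
    show ?case by (rule laurent_approximable_mult_powi[OF S g])
  next
    case (add f1 f2)
    then show ?case using laurent_approximable_add[OF add.IH] by (simp add: ring_distribs)
  qed
  moreover have "norm (f z * g z - \<psi> z * g z) \<le> e" if "z \<in> S" for z
  proof -
    have "norm (f z * g z - \<psi> z * g z) = norm (f z - \<psi> z) * norm (g z)"
      by (simp add: norm_mult flip: left_diff_distrib)
    also have "\<dots> \<le> e / B * B" using \<psi>(2) B that \<open>e > 0\<close> by (intro mult_mono) auto
    finally show ?thesis using B by simp
  qed
  ultimately show "\<exists>\<psi>. laurent_approximable S \<psi> \<and> (\<forall>z\<in>S. norm (f z * g z - \<psi> z) \<le> e)" by blast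
qed

text \<open>
  The partial sums of the geometric series converge uniformly because the ratio is bounded by
  \<open>q < 1\<close> on \<open>S\<close>.
\<close>

lemma laurent_approximable_geometric:
  assumes S: "0 \<notin> S" "\<And>k. bounded ((\<lambda>z. z powi k) ` S)"
    and v: "\<And>z. z \<in> S \<Longrightarrow> norm (c * z powi k) \<le> q" and q: "q < 1"
  shows "laurent_approximable S (\<lambda>z. 1 / (1 - c * z powi k))"
proof (cases "S = {}")
  case False
  then have q0: "q \<ge> 0" using v norm_ge_zero order_trans by (metis ex_in_conv)
  let ?v = "\<lambda>z. c * z powi k"
  show ?thesis
  proof (rule laurent_approximable_limit)
    fix e :: real assume "e > 0"
    have "(\<lambda>n. q ^ n / (1 - q)) \<longlonglongrightarrow> 0"
      using q0 q by (intro tendsto_divide_0 LIMSEQ_realpow_zero tendsto_const tendsto_divide_zero) auto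
    then have "\<forall>\<^sub>F n in sequentially. q ^ n / (1 - q) < e"
      using \<open>e > 0\<close> by (rule order_tendstoD)
    then obtain n where n: "q ^ n / (1 - q) < e" by (auto simp: eventually_sequentially)
    have "laurent_approximable S (\<lambda>z. \<Sum>i<m. ?v z ^ i)" for m
    proof (induction m)
      case 0
      then show ?case by (simp add: laurent_approximable_const)
    next
      case (Suc m)
      have "laurent_approximable S (\<lambda>z. 1 + ?v z * (\<Sum>i<m. ?v z ^ i))"
        by (intro laurent_approximable_add laurent_approximable_const laurent_approximable_mult_powi S Suc)
      then show ?case by (simp only: sum.lessThan_Suc_shift power_0 power_Suc sum_distrib_left)
    qed
    moreover have "norm (1 / (1 - ?v z) - (\<Sum>i<n. ?v z ^ i)) \<le> e" if "z \<in> S" for z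
    proof -
      have ne: "?v z \<noteq> 1" using v[OF that] q by (metis norm_one not_less)
      have "1 / (1 - w) - (\<Sum>i<n. w ^ i) = w ^ n / (1 - w)" if "w \<noteq> 1" for w :: complex
        using that by (simp add: sum_gp_strict field_simps)
      from this[OF ne] have "1 / (1 - ?v z) - (\<Sum>i<n. ?v z ^ i) = ?v z ^ n / (1 - ?v z)" .
      also have "norm \<dots> \<le> q ^ n / (1 - q)"
        unfolding norm_divide norm_power
      proof (intro frac_le power_mono v that)
        have "norm (1::complex) - norm (?v z) \<le> norm (1 - ?v z)" by (rule norm_triangle_ineq2)
        then show "1 - q \<le> norm (1 - ?v z)" using v[OF that] by simp
      qed (use q q0 in auto)
      finally show ?thesis using n by simp
    qed
    ultimately show "\<exists>\<psi>. laurent_approximable S \<psi> \<and> (\<forall>z\<in>S. norm (1 / (1 - ?v z) - \<psi> z) \<le> e)" by blast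
  qed
qed (simp add: laurent_approximable_def, use laurent.monom in blast)

text \<open>
  The point is approached along its own ray from the origin.
\<close>

lemma closure_annulus_superset:
  assumes "0 < R" "R < 1" "R \<le> norm a" "norm a \<le> 1"
  shows "a \<in> closure (annulus R)"
proof -
  have "(\<lambda>t. of_real t * sgn a) ` closure {R<..<1} \<subseteq> closure (annulus R)"
  proof (rule image_closure_subset)
    show "(\<lambda>t. of_real t * sgn a) ` {R<..<1} \<subseteq> closure (annulus R)"
      using assms by (intro image_subsetI subsetD[OF closure_subset]) (auto simp: annulus_def norm_mult norm_sgn)
  qed (auto intro!: continuous_intros)
  moreover have "norm a \<in> closure {R<..<1}" using assms by simp
  moreover have "a = of_real (norm a) * sgn a" by (simp add: sgn_eq)
  ultimately show ?thesis by blast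
qed

lemma closure_annulus_subset: "closure (annulus R) \<subseteq> {z. R \<le> norm z \<and> norm z \<le> 1}"
proof (rule closure_minimal)
  show "closed {z::complex. R \<le> norm z \<and> norm z \<le> 1}"
    by (intro closed_Collect_conj closed_Collect_le continuous_intros)
qed (auto simp: annulus_def)

lemma annulus_bdry_norm: "0 < R \<Longrightarrow> R < 1 \<Longrightarrow> z \<in> annulus_bdry R \<Longrightarrow> R \<le> norm z \<and> norm z \<le> 1"
  by (auto simp: annulus_bdry_def)

lemma annulus_bdry_subset: "0 < R \<Longrightarrow> R < 1 \<Longrightarrow> annulus_bdry R \<subseteq> closure (annulus R)"
  using closure_annulus_superset annulus_bdry_norm by blast

lemma bounded_powi_bdry: "0 < R \<Longrightarrow> bounded ((\<lambda>z. z powi k) ` annulus_bdry R)"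
  by (intro compact_imp_bounded compact_continuous_image compact_annulus_bdry continuous_intros)

text \<open>
  A pole inside the hole of the annulus is expanded in powers of \<open>a/z\<close>, a pole outside the unit
  disc in powers of \<open>z/a\<close>; in both cases the ratio is bounded away from 1 on the boundary.
\<close>

lemma laurent_approximable_inverse_linear:
  assumes R: "0 < R" "R < 1" and a: "a \<notin> closure (annulus R)"
  shows "laurent_approximable (annulus_bdry R) (\<lambda>z. 1 / (z - a))"
proof -
  let ?S = "annulus_bdry R"
  have S: "0 \<notin> ?S" "\<And>k. bounded ((\<lambda>z. z powi k) ` ?S)"
    using R bounded_powi_bdry nonzero_annulus_bdry by blast+
  consider "norm a < R" | "norm a > 1"
    using a closure_annulus_superset[OF R] by fastforce
  then show ?thesis
  proof cases
    case 1
    have "laurent_approximable ?S (\<lambda>z. 1 / (1 - a * z powi (-1)))"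
    proof (rule laurent_approximable_geometric[OF S])
      show "norm a / R < 1" using 1 R by simp
      fix z assume "z \<in> ?S"
      then show "norm (a * z powi - 1) \<le> norm a / R"
        using annulus_bdry_norm[OF R] R
        by (auto simp: norm_mult norm_inverse divide_inverse power_int_minus intro!: mult_left_mono le_imp_inverse_le)
    qed
    then have "laurent_approximable ?S (\<lambda>z. 1 * z powi (-1) * (1 / (1 - a * z powi (-1))))"
      by (rule laurent_approximable_mult_powi[OF S])
    then show ?thesis
    proof (rule laurent_approximable_cong)
      fix z assume "z \<in> ?S"
      then have "z \<noteq> 0" "z \<noteq> a" using S 1 annulus_bdry_norm[OF R, of z] by auto
      then show "1 * z powi (-1) * (1 / (1 - a * z powi (-1))) = 1 / (z - a)"
        by (simp add: power_int_minus field_simps)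
    qed
  next
    case 2
    have "laurent_approximable ?S (\<lambda>z. 1 / (1 - (1/a) * z powi 1))"
    proof (rule laurent_approximable_geometric[OF S])
      show "1 / norm a < 1" using 2 by (simp add: divide_less_eq)
      fix z assume "z \<in> ?S"
      then show "norm ((1/a) * z powi 1) \<le> 1 / norm a"
        using annulus_bdry_norm[OF R] by (auto simp: norm_mult norm_divide intro!: divide_right_mono)
    qed
    then have "laurent_approximable ?S (\<lambda>z. (-1/a) * z powi 0 * (1 / (1 - (1/a) * z powi 1)))"
      by (rule laurent_approximable_mult_powi[OF S])
    then show ?thesis
    proof (rule laurent_approximable_cong)
      fix z assume "z \<in> ?S"
      then have "a \<noteq> 0" "z \<noteq> a" using 2 annulus_bdry_norm[OF R, of z] by auto
      then show "(-1/a) * z powi 0 * (1 / (1 - (1/a) * z powi 1)) = 1 / (z - a)"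
        by (simp add: divide_simps)
    qed
  qed
qed

text \<open>
  The denominator splits into linear factors over the complex numbers, whose roots lie off the
  closed annulus; the inverse of each factor is approximable, and approximability is preserved by
  products of bounded functions.
\<close>

lemma laurent_approximable_rational:
  assumes R: "0 < R" "R < 1" and \<phi>: "\<phi> \<in> rational_no_poles R"
  shows "laurent_approximable (annulus_bdry R) \<phi>"
proof -
  let ?S = "annulus_bdry R"
  have S: "0 \<notin> ?S" "\<And>k. bounded ((\<lambda>z. z powi k) ` ?S)"
    using R bounded_powi_bdry nonzero_annulus_bdry by blast+
  obtain p q where \<phi>: "\<phi> = (\<lambda>z. poly p z / poly q z)" and nz: "\<And>z. z \<in> closure (annulus R) \<Longrightarrow> poly q z \<noteq> 0"
    using \<phi> by (auto simp: rational_no_poles_def)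
  have cont: "bounded (f ` ?S)" if "continuous_on ?S f" for f :: "complex \<Rightarrow> complex"
    using that by (intro compact_imp_bounded compact_continuous_image compact_annulus_bdry)
  have numerator: "laurent_approximable ?S (poly p)"
  proof (induction p)
    case 0
    then show ?case using laurent_approximable_const[of ?S 0] by (simp add: fun_eq_iff)
  next
    case (pCons a p)
    have "laurent_approximable ?S (\<lambda>z. a + 1 * z powi 1 * poly p z)"
      by (intro laurent_approximable_add laurent_approximable_const laurent_approximable_mult_powi S pCons)
    then show ?case by simp
  qed
  have "q \<noteq> 0" using nz[of 1] closure_annulus_superset[OF R, of 1] R by auto
  then obtain A where q: "q = smult (lead_coeff q) (\<Prod>x\<in>#A. [:-x, 1:])"
    using alg_closed_imp_factorization by blast
  have root: "x \<notin> closure (annulus R)" if "x \<in># A" for x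
  proof
    assume "x \<in> closure (annulus R)"
    moreover have "poly q x = 0"
      using that by (subst q) (auto simp: poly_prod_mset image_iff)
    ultimately show False using nz by blast
  qed
  have "laurent_approximable ?S (\<lambda>z. 1 / poly (\<Prod>x\<in>#B. [:-x, 1:]) z)"
    if "\<And>x. x \<in># B \<Longrightarrow> x \<notin> closure (annulus R)" for B
    using that
  proof (induction B)
    case empty
    then show ?case using laurent_approximable_const[of ?S 1] by simp
  next
    case (add x B)
    have x: "z \<noteq> x" if "z \<in> ?S" for z
      using add.prems[of x] annulus_bdry_subset[OF R] that by auto
    have "laurent_approximable ?S (\<lambda>z. 1 / poly (\<Prod>x\<in>#B. [:-x, 1:]) z * (1 / (z - x)))"
      using add x by (intro laurent_approximable_mult S laurent_approximable_inverse_linear R cont continuous_intros) auto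
    then show ?case by (rule laurent_approximable_cong) (simp add: algebra_simps)
  qed
  from this[OF root] have "laurent_approximable ?S (\<lambda>z. (1 / lead_coeff q) * z powi 0 * (1 / poly (\<Prod>x\<in>#A. [:-x, 1:]) z))"
    by (intro laurent_approximable_mult_powi[OF S])
  also have "(\<lambda>z. (1 / lead_coeff q) * z powi 0 * (1 / poly (\<Prod>x\<in>#A. [:-x, 1:]) z)) = (\<lambda>z. 1 / poly q z)"
    by (subst (3) q) simp
  finally have "laurent_approximable ?S (\<lambda>z. poly p z * (1 / poly q z))"
    using nz annulus_bdry_subset[OF R]
    by (intro laurent_approximable_mult S numerator cont continuous_intros) auto
  then show ?thesis by (simp add: \<phi>)
qed

section \<open>The Hardy space and its projection\<close>

lemma L2_bdry_eq: "L2_bdry R = l2_space (bdry_measure R)"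
  by (simp add: L2_bdry_def l2_space_def)

lemma inner_bdry_eq: "inner_bdry R = l2_inner (bdry_measure R)"
  by (simp add: inner_bdry_def l2_inner_def fun_eq_iff)

lemma norm_bdry_eq: "norm_bdry R = l2_norm (bdry_measure R)"
  by (simp add: norm_bdry_def l2_norm_def fun_eq_iff)

lemma l2_norm_cong_bdry:
  "(\<And>z. z \<in> annulus_bdry R \<Longrightarrow> f z = g z) \<Longrightarrow> l2_norm (bdry_measure R) f = l2_norm (bdry_measure R) g"
  unfolding l2_norm_def by (auto intro!: arg_cong[where f = sqrt] Bochner_Integration.integral_cong)

lemma rational_Linf_bdry:
  assumes "0 < R" "R < 1" "\<phi> \<in> rational_no_poles R"
  shows "\<phi> \<in> Linf_bdry R"
proof -
  obtain p q where "\<phi> = (\<lambda>z. poly p z / poly q z)" "\<forall>z\<in>closure (annulus R). poly q z \<noteq> 0"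
    using assms(3) by (auto simp: rational_no_poles_def)
  then show ?thesis
    using annulus_bdry_subset[OF assms(1,2)]
    by (auto intro!: continuous_on_imp_Linf_bdry continuous_intros)
qed

lemma rational_no_poles_combination:
  assumes "\<phi> \<in> rational_no_poles R" "\<psi> \<in> rational_no_poles R"
  shows "\<exists>\<xi>\<in>rational_no_poles R. \<forall>z\<in>closure (annulus R). \<xi> z = \<phi> z + c * \<psi> z"
proof -
  obtain p q where \<phi>: "\<phi> = (\<lambda>z. poly p z / poly q z)" "\<forall>z\<in>closure (annulus R). poly q z \<noteq> 0"
    using assms(1) by (auto simp: rational_no_poles_def)
  obtain p' q' where \<psi>: "\<psi> = (\<lambda>z. poly p' z / poly q' z)" "\<forall>z\<in>closure (annulus R). poly q' z \<noteq> 0"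
    using assms(2) by (auto simp: rational_no_poles_def)
  let ?n = "p * q' + smult c (p' * q)" and ?d = "q * q'"
  have "(\<lambda>z. poly ?n z / poly ?d z) \<in> rational_no_poles R"
    unfolding rational_no_poles_def using \<phi>(2) \<psi>(2) by (intro CollectI exI[of _ ?n] exI[of _ ?d]) simp
  moreover have "poly ?n z / poly ?d z = \<phi> z + c * \<psi> z" if "z \<in> closure (annulus R)" for z
    using that \<phi> \<psi> by (simp add: field_simps)
  ultimately show ?thesis by (intro bexI[of _ "\<lambda>z. poly ?n z / poly ?d z"] ballI)
qed

lemma powi_rational_no_poles:
  assumes "0 < R"
  shows "(\<lambda>z. z powi n) \<in> rational_no_poles R"
proof -
  have nz: "z \<noteq> 0" if "z \<in> closure (annulus R)" for z
    using that closure_annulus_subset[of R] assms by auto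
  show ?thesis
  proof (cases "n \<ge> 0")
    case True
    have "(\<lambda>z::complex. z powi n) = (\<lambda>z. poly (monom 1 (nat n)) z / poly 1 z)"
      using True by (simp add: power_int_def poly_monom)
    moreover have "\<forall>z\<in>closure (annulus R). poly 1 z \<noteq> 0" by simp
    ultimately show ?thesis unfolding rational_no_poles_def by blast
  next
    case False
    have "(\<lambda>z::complex. z powi n) = (\<lambda>z. poly 1 z / poly (monom 1 (nat (- n))) z)"
      using False by (simp add: power_int_def poly_monom fun_eq_iff inverse_eq_divide power_divide)
    moreover have "\<forall>z\<in>closure (annulus R). poly (monom 1 (nat (- n))) z \<noteq> 0"
      using nz by (simp add: poly_monom)
    ultimately show ?thesis unfolding rational_no_poles_def by blast
  qed
qed

lemma l2_norm_le_sup: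
  assumes R: "0 < R" "R < 1" and u: "u \<in> Linf_bdry R" and bd: "\<And>z. z \<in> annulus_bdry R \<Longrightarrow> norm (u z) \<le> d" and "d \<ge> 0"
  shows "l2_norm (bdry_measure R) u \<le> d * l2_norm (bdry_measure R) (\<lambda>_. 1)"
proof -
  have one: "(\<lambda>_. 1) \<in> l2_space (bdry_measure R)"
    using R by (intro Linf_bdry_subset_l2 continuous_on_imp_Linf_bdry) auto
  have "l2_norm (bdry_measure R) (\<lambda>z. u z * 1) \<le> \<bar>d\<bar> * l2_norm (bdry_measure R) (\<lambda>_. 1)"
    by (rule l2_space_bounded_mult(2)[OF _ _ one]) (use u bd in auto)
  then show ?thesis using \<open>d \<ge> 0\<close> by simp
qed

lemma hardy_l2: "h \<in> hardy_bdry R \<Longrightarrow> h \<in> l2_space (bdry_measure R)"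
  by (simp add: hardy_bdry_def L2_bdry_eq)

lemma hardy_approx:
  "h \<in> hardy_bdry R \<Longrightarrow> e > 0 \<Longrightarrow> \<exists>\<phi>\<in>rational_no_poles R. l2_norm (bdry_measure R) (\<lambda>z. h z - \<phi> z) < e"
  by (simp add: hardy_bdry_def norm_bdry_eq)

lemma hardyI:
  assumes "h \<in> l2_space (bdry_measure R)"
    and "\<And>e. e > 0 \<Longrightarrow> \<exists>\<phi>\<in>rational_no_poles R. l2_norm (bdry_measure R) (\<lambda>z. h z - \<phi> z) < e"
  shows "h \<in> hardy_bdry R"
  using assms by (simp add: hardy_bdry_def L2_bdry_eq norm_bdry_eq)

lemma rational_hardy:
  assumes "0 < R" "R < 1" "\<phi> \<in> rational_no_poles R"
  shows "\<phi> \<in> hardy_bdry R"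
proof (rule hardyI)
  show "\<phi> \<in> l2_space (bdry_measure R)"
    using assms by (intro Linf_bdry_subset_l2 rational_Linf_bdry) auto
  show "\<exists>\<psi>\<in>rational_no_poles R. l2_norm (bdry_measure R) (\<lambda>z. \<phi> z - \<psi> z) < e" if "e > 0" for e
    using assms(3) that by (intro bexI[of _ \<phi>]) (simp_all add: l2_norm_def)
qed

lemma powi_hardy: "0 < R \<Longrightarrow> R < 1 \<Longrightarrow> (\<lambda>z. z powi n) \<in> hardy_bdry R"
  by (intro rational_hardy powi_rational_no_poles)

lemma hardy_combination:
  assumes R: "0 < R" "R < 1" and h: "h \<in> hardy_bdry R" and q: "q \<in> hardy_bdry R"
  shows "(\<lambda>z. h z + c * q z) \<in> hardy_bdry R"
proof (rule hardyI)
  let ?M = "bdry_measure R"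
  note hL = hardy_l2[OF h] and qL = hardy_l2[OF q]
  show "(\<lambda>z. h z + c * q z) \<in> l2_space ?M" by (intro l2_space_add l2_space_cmult hL qL)
  fix e :: real assume "e > 0"
  define d where "d = e / (2 * (norm c + 1))"
  have "norm c + 1 > 0" by (simp add: add_nonneg_pos)
  then have d: "d > 0" "norm c * d \<le> e / 2"
    using \<open>e > 0\<close> by (auto simp: d_def field_simps)
  obtain \<phi> where \<phi>: "\<phi> \<in> rational_no_poles R" "l2_norm ?M (\<lambda>z. h z - \<phi> z) < e / 2"
    using hardy_approx[OF h, of "e / 2"] \<open>e > 0\<close> by auto
  obtain \<psi> where \<psi>: "\<psi> \<in> rational_no_poles R" "l2_norm ?M (\<lambda>z. q z - \<psi> z) < d"
    using hardy_approx[OF q d(1)] by auto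
  obtain \<xi> where \<xi>: "\<xi> \<in> rational_no_poles R" "\<forall>z\<in>closure (annulus R). \<xi> z = \<phi> z + c * \<psi> z"
    using rational_no_poles_combination[OF \<phi>(1) \<psi>(1)] by blast
  have \<phi>L: "\<phi> \<in> l2_space ?M" and \<psi>L: "\<psi> \<in> l2_space ?M"
    using rational_hardy[OF R] \<phi> \<psi> hardy_l2 by blast+
  have "l2_norm ?M (\<lambda>z. h z + c * q z - \<xi> z) = l2_norm ?M (\<lambda>z. (h z - \<phi> z) + c * (q z - \<psi> z))"
    using \<xi>(2) annulus_bdry_subset[OF R] by (intro l2_norm_cong_bdry) (auto simp: algebra_simps)
  also have "\<dots> \<le> l2_norm ?M (\<lambda>z. h z - \<phi> z) + l2_norm ?M (\<lambda>z. c * (q z - \<psi> z))"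
    by (intro l2_norm_triangle l2_space_cmult l2_space_diff hL qL \<phi>L \<psi>L)
  also have "l2_norm ?M (\<lambda>z. c * (q z - \<psi> z)) \<le> norm c * d"
    unfolding l2_norm_cmult using \<psi>(2) by (intro mult_left_mono) auto
  finally have "l2_norm ?M (\<lambda>z. h z + c * q z - \<xi> z) < e" using \<phi>(2) d(2) by linarith
  then show "\<exists>\<xi>\<in>rational_no_poles R. l2_norm ?M (\<lambda>z. h z + c * q z - \<xi> z) < e" using \<xi>(1) by blast
qed

lemma hardy_closed:
  assumes R: "0 < R" "R < 1" and p: "p \<in> l2_space (bdry_measure R)"
    and approx: "\<And>e. e > 0 \<Longrightarrow> \<exists>h\<in>hardy_bdry R. l2_norm (bdry_measure R) (\<lambda>z. p z - h z) < e"
  shows "p \<in> hardy_bdry R"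
proof (rule hardyI[OF p])
  let ?M = "bdry_measure R"
  fix e :: real assume "e > 0"
  then obtain h where h: "h \<in> hardy_bdry R" "l2_norm ?M (\<lambda>z. p z - h z) < e / 2"
    using approx[of "e / 2"] by auto
  obtain \<phi> where \<phi>: "\<phi> \<in> rational_no_poles R" "l2_norm ?M (\<lambda>z. h z - \<phi> z) < e / 2"
    using hardy_approx[OF h(1), of "e / 2"] \<open>e > 0\<close> by auto
  have "l2_norm ?M (\<lambda>z. p z - \<phi> z) \<le> l2_norm ?M (\<lambda>z. p z - h z) + l2_norm ?M (\<lambda>z. h z - \<phi> z)"
    using rational_hardy[OF R \<phi>(1)] h(1) by (intro l2_norm_triangle_diff p hardy_l2)
  then show "\<exists>\<phi>\<in>rational_no_poles R. l2_norm ?M (\<lambda>z. p z - \<phi> z) < e"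
    using h(2) \<phi> by (intro bexI[OF _ \<phi>(1)]) linarith
qed

text \<open>
  The choice in \<open>hardy_proj\<close> is meaningful because the Hardy space is a closed subspace of
  \<open>L\<^sup>2\<close>, so that a projection exists to be chosen.
\<close>

lemma hardy_proj_properties:
  assumes R: "0 < R" "R < 1" and u: "u \<in> l2_space (bdry_measure R)"
  shows "hardy_proj R u \<in> hardy_bdry R"
    and "q \<in> hardy_bdry R \<Longrightarrow> l2_inner (bdry_measure R) (hardy_proj R u) q = l2_inner (bdry_measure R) u q"
proof -
  let ?M = "bdry_measure R"
  have zero: "(\<lambda>_. 0) \<in> hardy_bdry R"
    using hardy_combination[OF R powi_hardy[OF R] powi_hardy[OF R], of 0 "-1" 0] by simp
  have "finite_measure ?M" using R by (intro finite_measure_bdry) auto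
  then obtain p where "p \<in> hardy_bdry R" "\<And>q. q \<in> hardy_bdry R \<Longrightarrow> l2_inner ?M (\<lambda>z. u z - p z) q = 0"
    using l2_projection_exists[OF _ _ zero hardy_combination[OF R] hardy_closed[OF R] u]
    by (metis hardy_l2 subsetI)
  then have *: "hardy_proj R u \<in> hardy_bdry R \<and> (\<forall>q\<in>hardy_bdry R. l2_inner ?M (\<lambda>z. u z - hardy_proj R u z) q = 0)"
    unfolding hardy_proj_def inner_bdry_eq by (intro someI[where P = "\<lambda>p. p \<in> hardy_bdry R \<and> (\<forall>q\<in>hardy_bdry R. l2_inner ?M (\<lambda>z. u z - p z) q = 0)"]) auto
  then show "hardy_proj R u \<in> hardy_bdry R" ..
  show "l2_inner ?M (hardy_proj R u) q = l2_inner ?M u q" if "q \<in> hardy_bdry R"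
    using * that l2_inner_diff_left[OF u hardy_l2 hardy_l2, of "hardy_proj R u" q] by auto
qed

lemma hardy_approx_laurent:
  assumes R: "0 < R" "R < 1" and h: "h \<in> hardy_bdry R" and "e > 0"
  shows "\<exists>\<psi>\<in>laurent UNIV. l2_norm (bdry_measure R) (\<lambda>z. h z - \<psi> z) < e"
proof -
  let ?M = "bdry_measure R"
  obtain \<phi> where \<phi>: "\<phi> \<in> rational_no_poles R" "l2_norm ?M (\<lambda>z. h z - \<phi> z) < e / 2"
    using hardy_approx[OF h, of "e / 2"] \<open>e > 0\<close> by auto
  define C where "C = l2_norm ?M (\<lambda>_. 1)"
  define d where "d = e / (2 * (C + 1))"
  have "C \<ge> 0" by (simp add: C_def)
  then have d: "d > 0" "d * C \<le> e / 2" using \<open>e > 0\<close> by (auto simp: d_def field_simps)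
  obtain \<psi> where \<psi>: "\<psi> \<in> laurent UNIV" "\<forall>z\<in>annulus_bdry R. norm (\<phi> z - \<psi> z) \<le> d"
    using laurent_approximable_rational[OF R \<phi>(1)] d(1) by (auto simp: laurent_approximable_def)
  have \<phi>B: "\<phi> \<in> Linf_bdry R" and \<psi>B: "\<psi> \<in> Linf_bdry R"
    using rational_Linf_bdry[OF R \<phi>(1)] laurent_Linf_bdry[OF \<psi>(1) R(1)] by auto
  have L: "\<phi> \<in> l2_space ?M" "\<psi> \<in> l2_space ?M"
    using R \<phi>B \<psi>B by (auto intro: Linf_bdry_subset_l2)
  have "(\<lambda>z. \<phi> z - \<psi> z) \<in> Linf_bdry R"
    using Linf_bdry_add[OF \<phi>B Linf_bdry_cmult[OF \<psi>B, of "-1"]] by simp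
  then have "l2_norm ?M (\<lambda>z. \<phi> z - \<psi> z) \<le> d * C"
    unfolding C_def using \<psi>(2) d by (intro l2_norm_le_sup R) auto
  moreover have "l2_norm ?M (\<lambda>z. h z - \<psi> z) \<le> l2_norm ?M (\<lambda>z. h z - \<phi> z) + l2_norm ?M (\<lambda>z. \<phi> z - \<psi> z)"
    by (intro l2_norm_triangle_diff hardy_l2 h L)
  ultimately have "l2_norm ?M (\<lambda>z. h z - \<psi> z) < e" using \<phi>(2) d(2) by linarith
  then show ?thesis using \<psi>(1) by blast
qed

lemma fourier_coeff_one:
  assumes "k \<noteq> 0"
  shows "fourier_coeff (\<lambda>_. 1) r k = 0"
proof -
  define c where "c = (- \<i> * of_int k :: complex)"
  have c: "c \<noteq> 0" using assms by (simp add: c_def)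
  have eq: "cis (- of_int k * t) = exp (of_real t * c)" for t
    by (simp add: cis_conv_exp c_def mult_ac)
  have "(LBINT t:{0..2*pi}. exp (of_real t * c)) = exp (of_real (2*pi) * c) / c - exp (of_real 0 * c) / c"
    unfolding set_lebesgue_integral_def
  proof (rule integral_FTC_Icc)
    fix t :: real
    have "((\<lambda>z. exp (z * c) / c) has_field_derivative exp (of_real t * c)) (at (of_real t))"
      using c by (auto intro!: derivative_eq_intros)
    then show "((\<lambda>t. exp (of_real t * c) / c) has_vector_derivative exp (of_real t * c)) (at t within {0..2*pi})"
      by (rule has_vector_derivative_real_field)
  qed (auto intro!: continuous_intros)
  also have "exp (of_real (2*pi) * c) = 1"
    using eq[of "2*pi"] cis_multiple_2pi[of "- of_int k"] by (simp add: mult_ac)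
  finally show ?thesis by (simp only: fourier_coeff_def eq mult_1_left) simp
qed

lemma l2_inner_mult_powi:
  assumes R: "0 < R" "R < 1" and u: "u \<in> Linf_bdry R"
  shows "l2_inner (bdry_measure R) (\<lambda>z. u z * z powi n) (\<lambda>z. z powi m) =
    fourier_coeff u 1 (m - n) + of_real (R powi (n + m)) * fourier_coeff u R (m - n)"
  unfolding l2_inner_def using bdry_moment[OF assms] by simp

lemma powi_orthogonal:
  assumes R: "0 < R" "R < 1" and "n \<noteq> m"
  shows "l2_inner (bdry_measure R) (\<lambda>z. z powi n) (\<lambda>z. z powi m) = 0"
proof -
  have "(\<lambda>_. 1) \<in> Linf_bdry R" by (intro continuous_on_imp_Linf_bdry continuous_intros)
  from l2_inner_mult_powi[OF R this, of n m] show ?thesis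
    using assms(3) by (simp add: fourier_coeff_one)
qed

lemma powi_l2: "0 < R \<Longrightarrow> R < 1 \<Longrightarrow> (\<lambda>z. z powi n) \<in> l2_space (bdry_measure R)"
  by (intro hardy_l2 powi_hardy)

lemma laurent_l2: "0 < R \<Longrightarrow> R < 1 \<Longrightarrow> \<psi> \<in> laurent K \<Longrightarrow> \<psi> \<in> l2_space (bdry_measure R)"
  by (intro Linf_bdry_subset_l2 laurent_Linf_bdry) auto

lemma laurent_orthogonal:
  assumes R: "0 < R" "R < 1" and u: "u \<in> l2_space (bdry_measure R)" and "\<psi> \<in> laurent K"
    and orth: "\<And>k. k \<in> K \<Longrightarrow> l2_inner (bdry_measure R) (\<lambda>z. z powi k) u = 0"
  shows "l2_inner (bdry_measure R) \<psi> u = 0"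
  using assms(4)
proof induction
  case (monom k c)
  then show ?case by (simp add: l2_inner_cmult_left orth)
next
  case (add f g)
  then show ?case by (simp add: l2_inner_add_left laurent_l2[OF R] u)
qed

text \<open>
  The function \<open>q\<close> has only components of degree below \<open>m\<^sub>0\<close>, and \<open>u\<close> is orthogonal to those. To avoid
  summing the expansion of \<open>q\<close>, a Laurent polynomial close to \<open>q\<close> is split at degree \<open>m\<^sub>0\<close>: its upper
  part is orthogonal to \<open>q\<close> and to its lower part, so by Pythagoras the lower part alone is at least
  as close to \<open>q\<close>.
\<close>

lemma hardy_orthogonal_of_low_degree:
  assumes R: "0 < R" "R < 1" and q: "q \<in> hardy_bdry R"
    and high: "\<And>m. m \<ge> m0 \<Longrightarrow> l2_inner (bdry_measure R) q (\<lambda>z. z powi m) = 0"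
    and u: "u \<in> l2_space (bdry_measure R)"
    and low: "\<And>m. m < m0 \<Longrightarrow> l2_inner (bdry_measure R) (\<lambda>z. z powi m) u = 0"
  shows "l2_inner (bdry_measure R) q u = 0"
proof -
  let ?M = "bdry_measure R"
  have qL: "q \<in> l2_space ?M" by (rule hardy_l2[OF q])
  have small: "norm (l2_inner ?M q u) \<le> e * l2_norm ?M u" if "e > 0" for e
  proof -
    obtain \<psi> where \<psi>: "\<psi> \<in> laurent UNIV" "l2_norm ?M (\<lambda>z. q z - \<psi> z) < e"
      using hardy_approx_laurent[OF R q \<open>e > 0\<close>] by blast
    obtain lo hi where lo: "lo \<in> laurent {..<m0}" and hi: "hi \<in> laurent {m0..}" and split: "\<forall>z. \<psi> z = lo z + hi z"
      using laurent_split[OF \<psi>(1), of m0] by blast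
    note loL = laurent_l2[OF R lo] and hiL = laurent_l2[OF R hi]
    have hi_q: "l2_inner ?M hi q = 0"
      using high by (intro laurent_orthogonal[OF R qL hi]) (subst l2_inner_commute, simp)
    have "l2_inner ?M (\<lambda>z. z powi k) lo = 0" if "k \<ge> m0" for k
    proof -
      have "l2_inner ?M lo (\<lambda>z. z powi k) = 0"
        using that by (intro laurent_orthogonal[OF R powi_l2[OF R] lo] powi_orthogonal[OF R]) auto
      then show ?thesis by (subst l2_inner_commute) simp
    qed
    then have hi_lo: "l2_inner ?M hi lo = 0"
      by (intro laurent_orthogonal[OF R loL hi]) simp
    have qlo: "(\<lambda>z. q z - lo z) \<in> l2_space ?M" by (intro l2_space_diff qL loL)
    have "l2_inner ?M (\<lambda>z. q z - lo z) hi = 0"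
      using l2_inner_diff_left[OF qL loL hiL] hi_q hi_lo
      by (simp add: l2_inner_commute[of M q hi for M] l2_inner_commute[of M lo hi for M])
    then have "l2_inner ?M (\<lambda>z. q z - lo z) (\<lambda>z. -1 * hi z) = 0"
      by (simp only: l2_inner_cmult_right) simp
    from l2_norm_add_sq[OF qlo l2_space_cmult[OF hiL], of "-1"] this
    have "(l2_norm ?M (\<lambda>z. q z - \<psi> z))\<^sup>2 = (l2_norm ?M (\<lambda>z. q z - lo z))\<^sup>2 + (l2_norm ?M (\<lambda>z. -1 * hi z))\<^sup>2"
      using split by (simp add: algebra_simps)
    then have "l2_norm ?M (\<lambda>z. q z - lo z) \<le> l2_norm ?M (\<lambda>z. q z - \<psi> z)"
      by (intro power2_le_imp_le[OF _ l2_norm_nonneg]) (simp only: le_add_same_cancel1 zero_le_power2)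
    then have "l2_norm ?M (\<lambda>z. q z - lo z) \<le> e" using \<psi>(2) by linarith
    moreover have "l2_inner ?M q u = l2_inner ?M (\<lambda>z. q z - lo z) u"
      using l2_inner_diff_left[OF qL loL u] laurent_orthogonal[OF R u lo] low by simp
    ultimately show ?thesis
      using l2_Cauchy_Schwarz[OF qlo u] mult_right_mono[OF _ l2_norm_nonneg] by (metis order_trans)
  qed
  have "norm (l2_inner ?M q u) \<le> 0"
  proof (rule field_le_epsilon)
    fix e :: real assume "e > 0"
    have "e / (a + 1) > 0 \<and> e / (a + 1) * a \<le> e" if "a \<ge> 0" for a
      using \<open>e > 0\<close> that by (auto simp: field_simps)
    from this[OF l2_norm_nonneg] show "norm (l2_inner ?M q u) \<le> 0 + e"
      using small by (metis add_0 order_trans)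
  qed
  then show ?thesis by simp
qed

section \<open>Leading coefficients and the zero product theorem\<close>

text \<open>
  By uniqueness some coefficient is nonzero, and the indices of nonzero coefficients are bounded
  above by \<open>N\<close>. The largest index is taken over both circles together, so at \<open>d\<close> one of the two
  coefficients may be zero.
\<close>

lemma top_fourier_coeff:
  assumes R: "0 < R" "R < 1" and u: "u \<in> Linf_bdry R" and nz: "\<not> (AE z in bdry_measure R. u z = 0)"
    and vanish: "\<And>r k. r \<in> {R, 1} \<Longrightarrow> k > N \<Longrightarrow> fourier_coeff u r k = 0"
  obtains d where "fourier_coeff u 1 d \<noteq> 0 \<or> fourier_coeff u R d \<noteq> 0"
    "\<And>k. k > d \<Longrightarrow> fourier_coeff u 1 k = 0 \<and> fourier_coeff u R k = 0"
proof -
  let ?P = "\<lambda>k. fourier_coeff u 1 k \<noteq> 0 \<or> fourier_coeff u R k \<noteq> 0"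
  obtain k0 where k0: "?P k0" using fourier_uniqueness[OF R u] nz by blast
  have le: "k \<le> N" if "?P k" for k using vanish that by (meson insertI1 insertI2 not_le)
  define d where "d = Max {k \<in> {k0..N}. ?P k}"
  have fin: "finite {k \<in> {k0..N}. ?P k}" by (rule finite_subset[of _ "{k0..N}"]) auto
  have "k0 \<in> {k \<in> {k0..N}. ?P k}" using k0 le by simp
  then have d: "d \<in> {k \<in> {k0..N}. ?P k}" unfolding d_def using fin by (intro Max_in) auto
  show ?thesis
  proof
    show "?P d" using d by simp
    fix k assume "k > d"
    show "fourier_coeff u 1 k = 0 \<and> fourier_coeff u R k = 0"
    proof (rule ccontr)
      assume "\<not> ?thesis"
      then have "k \<in> {k \<in> {k0..N}. ?P k}" using \<open>k > d\<close> d le by auto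
      then show False using \<open>k > d\<close> Max_ge[OF fin] unfolding d_def by fastforce
    qed
  qed
qed

text \<open>
  Two zeros would force \<open>b = 0\<close>, since \<open>R\<^sup>2\<^sup>m \<noteq> R\<^sup>2\<^sup>n\<close> for \<open>m \<noteq> n\<close>, and then also \<open>a = 0\<close>.
\<close>

lemma exponential_at_most_one_zero:
  fixes a b :: complex and m n s :: int
  assumes R: "0 < R" "R < 1" and ab: "a \<noteq> 0 \<or> b \<noteq> 0"
    and m: "a + of_real (R powi (2 * m + s)) * b = 0" and n: "a + of_real (R powi (2 * n + s)) * b = 0"
  shows "m = n"
proof (rule ccontr)
  assume "m \<noteq> n"
  then have "R powi (2 * m + s) \<noteq> R powi (2 * n + s)"
    using power_int_strict_decreasing[of "2 * m + s" "2 * n + s" R] power_int_strict_decreasing[of "2 * n + s" "2 * m + s" R] R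
    by (cases "m < n") auto
  moreover have "of_real (R powi (2 * m + s)) * b = of_real (R powi (2 * n + s)) * b"
    using m n by (metis add_left_cancel)
  ultimately have "b = 0" by (simp only: mult_cancel_right of_real_eq_iff) blast
  then show False using m ab by simp
qed

theorem theorem2p4:
  fixes R :: real and N N' :: int and f g :: "complex \<Rightarrow> complex"
  assumes "0 < R" and "R < 1"
    and "f \<in> Linf_bdry R" and "g \<in> Linf_bdry R"
    and "\<And>r k. r \<in> {R, 1} \<Longrightarrow> k > N \<Longrightarrow> fourier_coeff g r k = 0"
    and "\<And>r k. r \<in> {R, 1} \<Longrightarrow> k > N' \<Longrightarrow> fourier_coeff f r k = 0"
    and "\<And>h. h \<in> hardy_bdry R \<Longrightarrow>
      AE z in bdry_measure R. toeplitz R f (toeplitz R g h) z = 0"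
  shows "(AE z in bdry_measure R. f z = 0) \<or> (AE z in bdry_measure R. g z = 0)"
proof (rule ccontr)
  let ?M = "bdry_measure R"
  assume "\<not> ?thesis"
  then have nzf: "\<not> (AE z in ?M. f z = 0)" and nzg: "\<not> (AE z in ?M. g z = 0)" by auto
  note R = assms(1,2) and f = assms(3) and g = assms(4)
  obtain a where a: "fourier_coeff f 1 a \<noteq> 0 \<or> fourier_coeff f R a \<noteq> 0"
    and f0: "\<And>k. k > a \<Longrightarrow> fourier_coeff f 1 k = 0 \<and> fourier_coeff f R k = 0"
    using top_fourier_coeff[OF R f nzf assms(6)] by blast
  obtain b where b: "fourier_coeff g 1 b \<noteq> 0 \<or> fourier_coeff g R b \<noteq> 0"
    and g0: "\<And>k. k > b \<Longrightarrow> fourier_coeff g 1 k = 0 \<and> fourier_coeff g R k = 0"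
    using top_fourier_coeff[OF R g nzg assms(5)] by blast
  \<comment> \<open>The factors \<open>\<beta> n\<close> and \<open>\<alpha> (n + b)\<close> are the leading matrix entries of the two Toeplitz operators.\<close>
  define \<beta> where "\<beta> n = fourier_coeff g 1 b + of_real (R powi (2 * n + b)) * fourier_coeff g R b" for n
  define \<alpha> where "\<alpha> m = fourier_coeff f 1 a + of_real (R powi (2 * m + a)) * fourier_coeff f R a" for m
  have \<beta>_zero: "m = n" if "\<beta> m = 0" "\<beta> n = 0" for m n
    using exponential_at_most_one_zero[OF R b] that unfolding \<beta>_def by blast
  have \<alpha>_zero: "m = n" if "\<alpha> (m + b) = 0" "\<alpha> (n + b) = 0" for m n
    using exponential_at_most_one_zero[OF R a, of "m + b" a "n + b"] that unfolding \<alpha>_def by simp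
  \<comment> \<open>Each factor excludes at most one \<open>n\<close>, so one of three values of \<open>n\<close> remains.\<close>
  have "\<exists>n. \<beta> n \<noteq> 0 \<and> \<alpha> (n + b) \<noteq> 0"
  proof (rule ccontr)
    assume "\<nexists>n. \<beta> n \<noteq> 0 \<and> \<alpha> (n + b) \<noteq> 0"
    then have all: "\<beta> n = 0 \<or> \<alpha> (n + b) = 0" for n by blast
    have distinct: "(0::int) \<noteq> 1" "(0::int) \<noteq> 2" "(1::int) \<noteq> 2" by simp_all
    show False
      using all[of 0] all[of 1] all[of 2] \<beta>_zero \<alpha>_zero distinct by metis
  qed
  then obtain n where \<beta>: "\<beta> n \<noteq> 0" and \<alpha>: "\<alpha> (n + b) \<noteq> 0" by blast
  define m0 where "m0 = n + b"
  define l where "l = m0 + a"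
  let ?e = "\<lambda>k::int. \<lambda>z::complex. z powi k"
  have eL: "?e k \<in> l2_space ?M" for k by (rule powi_l2[OF R])
  have eH: "?e k \<in> hardy_bdry R" for k by (rule powi_hardy[OF R])
  obtain B where B: "AE z in ?M. norm (f z) \<le> B" using f by (auto simp: Linf_bdry_def)
  have geL: "(\<lambda>z. g z * ?e n z) \<in> l2_space ?M"
    using R by (intro Linf_bdry_subset_l2 Linf_bdry_mult g powi_Linf_bdry) auto
  define p where "p = toeplitz R g (?e n)"
  have pH: "p \<in> hardy_bdry R" unfolding p_def toeplitz_def by (rule hardy_proj_properties(1)[OF R geL])
  note pL = hardy_l2[OF pH]
  have p_inner: "l2_inner ?M p (?e m) = fourier_coeff g 1 (m - n) + of_real (R powi (n + m)) * fourier_coeff g R (m - n)" for m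
    unfolding p_def toeplitz_def hardy_proj_properties(2)[OF R geL eH] by (rule l2_inner_mult_powi[OF R g])
  have p_high: "l2_inner ?M p (?e m) = 0" if "m > m0" for m
    using that g0[of "m - n"] by (simp add: p_inner m0_def)
  have p_top: "l2_inner ?M p (?e m0) = \<beta> n"
    by (simp add: p_inner m0_def \<beta>_def algebra_simps)
  define s where "s = l2_inner ?M (?e m0) (?e m0)"
  have "s = of_real ((l2_norm ?M (?e m0))\<^sup>2)"
    unfolding s_def by (rule l2_inner_self)
  \<comment> \<open>By Cauchy-Schwarz, a function with a nonzero inner product has nonzero norm.\<close>
  moreover have "l2_norm ?M (?e m0) \<noteq> 0"
    using l2_Cauchy_Schwarz[OF pL eL[of m0]] p_top \<beta> by auto
  ultimately have s: "s \<noteq> 0" by simp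
  define c where "c = \<beta> n / s"
  have c: "c \<noteq> 0" using s \<beta> by (simp add: c_def)
  \<comment> \<open>Removing the leading term \<open>c z\<^bsup>m0\<^esup>\<close> from \<open>p = T\<^sub>g z\<^sup>n\<close> leaves only degrees below \<open>m0\<close>.\<close>
  define q where "q z = p z + (- c) * ?e m0 z" for z
  have qH: "q \<in> hardy_bdry R" unfolding q_def by (intro hardy_combination R pH eH)
  have q_high: "l2_inner ?M q (?e m) = 0" if "m \<ge> m0" for m
  proof -
    have "l2_inner ?M q (?e m) = l2_inner ?M p (?e m) + (- c) * l2_inner ?M (?e m0) (?e m)"
      unfolding q_def l2_inner_cmult_left[symmetric] by (intro l2_inner_add_left pL l2_space_cmult eL)
    then show ?thesis
      using that p_top p_high[of m] powi_orthogonal[OF R, of m0 m] s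
      by (cases "m = m0") (auto simp: c_def s_def)
  qed
  \<comment> \<open>Pairing \<open>f h\<close> with \<open>z\<^sup>l\<close> is pairing \<open>h\<close> with \<open>u\<close>; the degrees of \<open>u\<close> start at \<open>l - a = m0\<close>.\<close>
  define u where "u z = cnj (f z) * ?e l z" for z
  have inner_u: "l2_inner ?M h u = l2_inner ?M (\<lambda>z. f z * h z) (?e l)" for h
    by (simp add: l2_inner_def u_def mult_ac)
  have "cnj \<circ> f \<in> borel_measurable ?M" using f by measurable
  then have uL: "u \<in> l2_space ?M"
    unfolding u_def using B by (intro l2_space_bounded_mult(1)[OF _ _ eL]) (simp_all add: comp_def)
  have e_u: "l2_inner ?M (?e m) u = fourier_coeff f 1 (l - m) + of_real (R powi (m + l)) * fourier_coeff f R (l - m)" for m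
    unfolding inner_u by (rule l2_inner_mult_powi[OF R f])
  have "l2_inner ?M q u = 0"
  proof (rule hardy_orthogonal_of_low_degree[OF R qH q_high uL])
    show "l2_inner ?M (?e m) u = 0" if "m < m0" for m
      using f0[of "l - m"] that by (simp add: e_u l_def)
  qed
  moreover have "l2_inner ?M q u = l2_inner ?M p u + (- c) * l2_inner ?M (?e m0) u"
    unfolding q_def l2_inner_cmult_left[symmetric] by (intro l2_inner_add_left pL l2_space_cmult eL uL)
  moreover have "l2_inner ?M p u = 0"
  proof -
    have fpL: "(\<lambda>z. f z * p z) \<in> l2_space ?M"
      using f by (intro l2_space_bounded_mult(1)[OF _ B pL]) auto
    have "l2_inner ?M p u = l2_inner ?M (toeplitz R f p) (?e l)"
      unfolding inner_u toeplitz_def by (rule hardy_proj_properties(2)[OF R fpL eH, symmetric])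
    also have "\<dots> = 0"
      unfolding l2_inner_def using assms(7)[OF eH[of n], folded p_def]
      by (intro integral_eq_zero_AE) auto
    finally show ?thesis .
  qed
  moreover have "l2_inner ?M (?e m0) u = \<alpha> (n + b)"
    by (simp add: e_u l_def \<alpha>_def m0_def algebra_simps)
  ultimately show False using c \<alpha> by simp
qed

end
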